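(* Let $\mathbb{F}$ be a field of characteristic $0$, let $a,b,c,d,e,f\in\mathbb{F}$ be not all zero, and consider the operator identity $$R = a\,L^2(xy)+b\,L(L(x)y)+c\,L^2(x)y+d\,L(xL(y))+e\,L(x)L(y)+f\,xL^2(y)\in\mathcal{O}(2,2).$$ Let $M(R)$ be its matrix of consequences and $M(R)^t$ the transpose. (I) $M(R)^t$ has rank $16$ if and only if the parameters $a,b,c,d,e,f$ correspond (up to nonzero scalar multiples) to one of the following operator identities, which are obtained from the identities $L(xy)=L(x)y+xL(y)$, $L(xy)=L(x)y$, $L(xy)=xL(y)$, $L(xy)=0$, $L(x)y=0$, $xL(y)=0$ by replacing $L$ by $L^2$: 1. $L^2(xy)=L^2(x)y+xL^2(y)$; 2. $L^2(xy)=L^2(x)y$; 3. $L^2(xy)=xL^2(y)$; 4. $L^2(xy)=0$; 5. $L^2(x)y=0$; 6. $xL^2(y)=0$. (II) $M(R)^t$ has rank $19$ if and only if the parameters $a,b,c,d,e,f$ correspond (up to nonzero scalar multiples) to one of the following operator identities: 7. $L^2(xy)+L(xL(y))+xL^2(y)=0$; 8. $L^2(xy)+\delta\,L(xL(y))=(\delta+1)\,xL^2(y)$ for some $\delta\in\mathbb{F}$, $\delta\neq 0$; 9. $L^2(xy)+L(L(x)y)+L^2(x)y=0$; 10. $L^2(xy)+\beta\,L(L(x)y)=(\beta+1)\,L^2(x)y$ for some $\beta\in\mathbb{F}$, $\beta\neq 0$; 11. $L^2(xy)+L^2(x)y+xL^2(y)=2\big[L(L(x)y)+L(xL(y))-L(x)L(y)\big]$;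 12. $L^2(xy)+L(x)L(y)=L(L(x)y)+L(xL(y))$; 13. $L(L(x)y)=L^2(x)y$; 14. $L(L(x)y)=L(x)L(y)$; 15. $L(L(x)y)=0$; 16. $L(L(x)y)+L(xL(y))=L(x)L(y)$; 17. $L(xL(y))=L(x)L(y)$; 18. $L(xL(y))=xL^2(y)$; 19. $L(xL(y))=0$; 20. $L(x)L(y)=0$. (III) For all other values of the parameters (not all zero), the matrix $M(R)^t$ has full rank $20$.
   Context: Operator monomials. An operator monomial is a formal expression built from argument symbols, an associative (non-unital) product written as juxtaposition, and a formal unary operator symbol $L$: a single argument is an operator monomial; if $m$ is one then so is $L(m)$; if $m,m'$ are operator monomials then so is the product $mm'$, and $(mm')m''=m(m'm'')$. We write $L^2(m)=L(L(m))$. The degree is the number of arguments and the multiplicity is the number of occurrences of $L$. The arguments are always $a_1,a_2,\dots,a_p$ in this order from left to right (for $p=2$ written $x,y$), each occurring once. $\mathcal{M}(p,q)$ is the set of all operator monomials of degree $p$ and multiplicity $q$, and $\mathcal{O}(p,q)$ is the vector space over the base field $\mathbb{F}$ (of characteristic $0$) with basis $\mathcal{M}(p,q)$. $L$ is treated as linear and the product as bilinear. An operator identity of degree $p$ and multiplicity $q$ is a nonzero element $R\in\mathcal{O}(p,q)$; it is also written as an equation $R=0$ or $I_1=I_2$ with $R=I_1-I_2$. One has $\mathcal{M}(2,2)=\{L^2(xy),\,L(L(x)y),\,L^2(x)y,\,L(xL(y)),\,L(x)L(y),\,xL^2(y)\}$ and $|\mathcal{M}(3,3)|=50$. Partial compositions.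 For $m\in\mathcal{M}(p,q)$ (all operations below are extended linearly to $\mathcal{O}(p,q)$): - $m\circ_i B\in\mathcal{M}(p+1,q)$, $1\le i\le p$: replace the $i$-th argument of $m$ by the product of two arguments, then relabel all arguments $a_1,\dots,a_{p+1}$ from left to right. - $B\circ_1 m\in\mathcal{M}(p+1,q)$ (resp. $B\circ_2 m$): multiply $m$ on the right (resp. on the left) by a new argument, then relabel the arguments from left to right. - $m\circ_i L\in\mathcal{M}(p,q+1)$, $1\le i\le p$: replace the $i$-th argument $a_i$ of $m$ by $L(a_i)$. - $L\circ m\in\mathcal{M}(p,q+1)$: the monomial $L(m)$. Matrix of consequences. For $R\in\mathcal{O}(2,q)$, consider the following $28$ elements of $\mathcal{O}(3,q+1)$: (i) $(R\circ_i B)\circ_k L$, $(B\circ_j R)\circ_k L$, $L\circ(R\circ_i B)$, $L\circ(B\circ_j R)$ with $1\le i\le 2$, $1\le j\le 2$, $1\le k\le 3$ (these are $16$ elements); (ii) $(R\circ_i L)\circ_k B$, $(L\circ R)\circ_k B$, $B\circ_j(R\circ_i L)$, $B\circ_j(L\circ R)$ with $1\le i,k\le 2$, $1\le j\le 2$ (these are $12$ elements). Eight of the elements in (ii) coincide with elements in (i); the remaining ones in (ii) are $(R\circ_1 L)\circ_1 B$, $(R\circ_2 L)\circ_2 B$, $B\circ_1(L\circ R)$, $B\circ_2(L\circ R)$. The matrix of consequences $M(R)$ is the matrix whose rows are the coefficient vectors of the resulting $20$ elements (the $16$ in (i) and these $4$) with respect to the basis $\mathcal{M}(3,q+1)$ (in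 any fixed order). For $q=2$ it has size $20\times 50$, and its transpose $M(R)^t$ has size $50\times 20$. *)

theory Defs
  imports "HOL-Library.Poly_Mapping" "Jordan_Normal_Form.DL_Rank"
begin

text \<open>
  Operator monomials modulo associativity of the product are represented by their normal form: a
  word of factors, each factor being an argument \<open>a\<^sub>i\<close> or \<open>L\<close> applied to a word; the product is
  concatenation. The product is non-unital, so the empty word is excluded at every level; this is
  the role of the predicate \<open>opmonomial\<close>.
\<close>

datatype factor = Arg nat | Op "factor list"

type_synonym opword = "factor list"

definition arg :: "nat \<Rightarrow> opword"
  where "arg i = [Arg i]"

definition L :: "opword \<Rightarrow> opword"
  where "L m = [Op m]"

definition prd :: "opword \<Rightarrow> opword \<Rightarrow> opword"  (infixl \<open>\<diamondop>\<close> 70)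
  where "m \<diamondop> m' = m @ m'"

inductive opmonomial :: "opword \<Rightarrow> bool" where
  "opmonomial (arg i)"
| "opmonomial m \<Longrightarrow> opmonomial (L m)"
| "opmonomial m \<Longrightarrow> opmonomial m' \<Longrightarrow> opmonomial (m \<diamondop> m')"

fun args :: "opword \<Rightarrow> nat list" where
  "args [] = []"
| "args (Arg i # w) = i # args w"
| "args (Op u # w) = args u @ args w"

definition opdegree :: "opword \<Rightarrow> nat"
  where "opdegree m = length (args m)"

fun opmultiplicity :: "opword \<Rightarrow> nat" where
  "opmultiplicity [] = 0"
| "opmultiplicity (Arg i # w) = opmultiplicity w"
| "opmultiplicity (Op u # w) = Suc (opmultiplicity u + opmultiplicity w)"

definition opmonomials :: "nat \<Rightarrow> nat \<Rightarrow> opword set"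
  where "opmonomials p q = {m. opmonomial m \<and> args m = [1..<p + 1] \<and> opmultiplicity m = q}"

text \<open>Finiteness ensures that the basis \<open>opmonomials p q\<close> can be enumerated by a list.\<close>

lemma finite_opwords:
  "finite {m. opdegree m + opmultiplicity m \<le> n \<and> set (args m) \<subseteq> {..p}}" (is "finite (?W n)")
proof (induction n)
  case 0
  have "m = []" if "m \<in> ?W 0" for m
    using that by (cases m rule: args.cases) (auto simp: opdegree_def)
  then have "?W 0 \<subseteq> {[]}"
    by blast
  then show ?case
    using finite_subset by blast
next
  case (Suc n)
  have "m \<in> insert [] ((\<lambda>(i, w). Arg i # w) ` ({..p} \<times> ?W n)
      \<union> (\<lambda>(u, w). Op u # w) ` (?W n \<times> ?W n))" if "m \<in> ?W (Suc n)" for m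
    using that by (cases m rule: args.cases) (auto simp: opdegree_def image_iff)
  then have "?W (Suc n) \<subseteq> insert [] ((\<lambda>(i, w). Arg i # w) ` ({..p} \<times> ?W n)
      \<union> (\<lambda>(u, w). Op u # w) ` (?W n \<times> ?W n))"
    by blast
  moreover have "finite (insert [] ((\<lambda>(i, w). Arg i # w) ` ({..p} \<times> ?W n)
      \<union> (\<lambda>(u, w). Op u # w) ` (?W n \<times> ?W n)))"
    using Suc by blast
  ultimately show ?case
    by (rule finite_subset)
qed

lemma finite_opmonomials: "finite (opmonomials p q)"
  by (rule finite_subset[OF _ finite_opwords[of "p + q" p]])
    (auto simp: opmonomials_def opdegree_def)

fun opsubst :: "(nat \<Rightarrow> opword) \<Rightarrow> opword \<Rightarrow> opword" where
  "opsubst \<sigma> [] = []"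
| "opsubst \<sigma> (Arg i # w) = \<sigma> i @ opsubst \<sigma> w"
| "opsubst \<sigma> (Op u # w) = Op (opsubst \<sigma> u) # opsubst \<sigma> w"

text \<open>
  The partial compositions \<open>m \<circ>\<^sub>i B\<close>, \<open>B \<circ>\<^sub>j m\<close> (\<open>j \<in> {1, 2}\<close>) and \<open>m \<circ>\<^sub>i L\<close> for a monomial \<open>m\<close> with
  arguments \<open>a\<^sub>1, \<dots>, a\<^sub>p\<close> in this order; the substitutions include the relabelling. The remaining
  composition \<open>L \<circ> m\<close> is \<open>L m\<close>.
\<close>

definition comp_B :: "nat \<Rightarrow> opword \<Rightarrow> opword"
  where "comp_B i m =
    opsubst (\<lambda>j. if j < i then arg j else if j = i then arg i \<diamondop> arg (i + 1) else arg (j + 1)) m"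

definition B_comp :: "nat \<Rightarrow> opword \<Rightarrow> opword"
  where "B_comp j m =
    (if j = 1 then m \<diamondop> arg (opdegree m + 1) else arg 1 \<diamondop> opsubst (\<lambda>i. arg (i + 1)) m)"

definition comp_L :: "nat \<Rightarrow> opword \<Rightarrow> opword"
  where "comp_L i m = opsubst (\<lambda>j. if j = i then L (arg j) else arg j) m"

text \<open>
  Elements of \<open>\<O>(p, q)\<close> are finitely supported functions on words, with support in
  \<open>opmonomials p q\<close>.
\<close>

abbreviation bas :: "opword \<Rightarrow> opword \<Rightarrow>\<^sub>0 'a::field"
  where "bas m \<equiv> Poly_Mapping.single m 1"

definition scal :: "'a::field \<Rightarrow> (opword \<Rightarrow>\<^sub>0 'a) \<Rightarrow> opword \<Rightarrow>\<^sub>0 'a"  (infixr \<open>\<cdot>\<close> 75)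
  where "c \<cdot> R = Poly_Mapping.map (\<lambda>z. c * z) R"

definition lin :: "(opword \<Rightarrow> opword) \<Rightarrow> (opword \<Rightarrow>\<^sub>0 'a::field) \<Rightarrow> opword \<Rightarrow>\<^sub>0 'a"
  where "lin \<phi> R = (\<Sum>m\<in>Poly_Mapping.keys R. Poly_Mapping.single (\<phi> m) (Poly_Mapping.lookup R m))"

text \<open>
  The first four lists are the 16 consequences of type (i); the last two contain the four elements
  of type (ii) that do not already occur among those.
\<close>

definition consequences :: "(opword \<Rightarrow>\<^sub>0 'a::field) \<Rightarrow> (opword \<Rightarrow>\<^sub>0 'a) list"
  where "consequences R =
      [lin (comp_L k) (lin (comp_B i) R). i \<leftarrow> [1, 2], k \<leftarrow> [1, 2, 3]]
    @ [lin (comp_L k) (lin (B_comp j) R). j \<leftarrow> [1, 2], k \<leftarrow> [1, 2, 3]]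
    @ [lin L (lin (comp_B i) R). i \<leftarrow> [1, 2]]
    @ [lin L (lin (B_comp j) R). j \<leftarrow> [1, 2]]
    @ [lin (comp_B i) (lin (comp_L i) R). i \<leftarrow> [1, 2]]
    @ [lin (B_comp j) (lin L R). j \<leftarrow> [1, 2]]"

text \<open>The list \<open>bs\<close> is an enumeration of the basis \<open>opmonomials 3 (q + 1)\<close>; it fixes the order of
  the columns.\<close>

definition consequence_matrix :: "opword list \<Rightarrow> (opword \<Rightarrow>\<^sub>0 'a::field) \<Rightarrow> 'a mat"
  where "consequence_matrix bs R =
    mat (length (consequences R)) (length bs)
      (\<lambda>(i, j). Poly_Mapping.lookup (consequences R ! i) (bs ! j))"

definition mat_rank :: "'a::field mat \<Rightarrow> nat"
  where "mat_rank A = vec_space.rank (dim_row A) A"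

definition proportional :: "(opword \<Rightarrow>\<^sub>0 'a::field) \<Rightarrow> (opword \<Rightarrow>\<^sub>0 'a) \<Rightarrow> bool"  (infix \<open>\<propto>\<close> 50)
  where "R \<propto> S \<longleftrightarrow> (\<exists>k. k \<noteq> 0 \<and> R = k \<cdot> S)"

abbreviation X :: opword where "X \<equiv> arg 1"
abbreviation Y :: opword where "Y \<equiv> arg 2"
abbreviation L2 :: "opword \<Rightarrow> opword" where "L2 m \<equiv> L (L m)"

text \<open>An identity \<open>I\<^sub>1 = I\<^sub>2\<close> is the element \<open>I\<^sub>1 - I\<^sub>2\<close>.\<close>

definition rank16_identity :: "(opword \<Rightarrow>\<^sub>0 'a::field) \<Rightarrow> bool"
  where "rank16_identity R \<longleftrightarrow>
      R \<propto> bas (L2 (X \<diamondop> Y)) - (bas (L2 X \<diamondop> Y) + bas (X \<diamondop> L2 Y))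
    \<or> R \<propto> bas (L2 (X \<diamondop> Y)) - bas (L2 X \<diamondop> Y)
    \<or> R \<propto> bas (L2 (X \<diamondop> Y)) - bas (X \<diamondop> L2 Y)
    \<or> R \<propto> bas (L2 (X \<diamondop> Y))
    \<or> R \<propto> bas (L2 X \<diamondop> Y)
    \<or> R \<propto> bas (X \<diamondop> L2 Y)"

definition rank19_identity :: "(opword \<Rightarrow>\<^sub>0 'a::field) \<Rightarrow> bool"
  where "rank19_identity R \<longleftrightarrow>
      R \<propto> bas (L2 (X \<diamondop> Y)) + bas (L (X \<diamondop> L Y)) + bas (X \<diamondop> L2 Y)
    \<or> (\<exists>\<delta>. \<delta> \<noteq> 0 \<and>
        R \<propto> bas (L2 (X \<diamondop> Y)) + \<delta> \<cdot> bas (L (X \<diamondop> L Y)) - (\<delta> + 1) \<cdot> bas (X \<diamondop> L2 Y))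
    \<or> R \<propto> bas (L2 (X \<diamondop> Y)) + bas (L (L X \<diamondop> Y)) + bas (L2 X \<diamondop> Y)
    \<or> (\<exists>\<beta>. \<beta> \<noteq> 0 \<and>
        R \<propto> bas (L2 (X \<diamondop> Y)) + \<beta> \<cdot> bas (L (L X \<diamondop> Y)) - (\<beta> + 1) \<cdot> bas (L2 X \<diamondop> Y))
    \<or> R \<propto> bas (L2 (X \<diamondop> Y)) + bas (L2 X \<diamondop> Y) + bas (X \<diamondop> L2 Y)
           - 2 \<cdot> (bas (L (L X \<diamondop> Y)) + bas (L (X \<diamondop> L Y)) - bas (L X \<diamondop> L Y))
    \<or> R \<propto> bas (L2 (X \<diamondop> Y)) + bas (L X \<diamondop> L Y) - (bas (L (L X \<diamondop> Y)) + bas (L (X \<diamondop> L Y)))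
    \<or> R \<propto> bas (L (L X \<diamondop> Y)) - bas (L2 X \<diamondop> Y)
    \<or> R \<propto> bas (L (L X \<diamondop> Y)) - bas (L X \<diamondop> L Y)
    \<or> R \<propto> bas (L (L X \<diamondop> Y))
    \<or> R \<propto> bas (L (L X \<diamondop> Y)) + bas (L (X \<diamondop> L Y)) - bas (L X \<diamondop> L Y)
    \<or> R \<propto> bas (L (X \<diamondop> L Y)) - bas (L X \<diamondop> L Y)
    \<or> R \<propto> bas (L (X \<diamondop> L Y)) - bas (X \<diamondop> L2 Y)
    \<or> R \<propto> bas (L (X \<diamondop> L Y))
    \<or> R \<propto> bas (L X \<diamondop> L Y)"

end

theory Submission
  imports Defs
begin

text \<open>
  Let \<open>s\<close>, \<open>p\<close>, \<open>q\<close> record an occurrence of \<open>L\<close> applied to the whole product \<open>xy\<close>, to \<open>x\<close> and to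
  \<open>y\<close>. A monomial of degree 2 is determined by how often each of these occurs, so that the identity
  \<open>R\<close> becomes the quadratic form \<open>R(s, p, q) = a s\<^sup>2 + b s p + c p\<^sup>2 + d s q + e p q + f q\<^sup>2\<close>. In the same
  way, with variables \<open>x, y, z, w, v, t\<close> for an \<open>L\<close> applied to the factor \<open>a\<^sub>1, a\<^sub>2, a\<^sub>3, a\<^sub>1a\<^sub>2, a\<^sub>2a\<^sub>3,
  a\<^sub>1a\<^sub>2a\<^sub>3\<close> of \<open>a\<^sub>1a\<^sub>2a\<^sub>3\<close>, the 50 monomials of degree 3 and multiplicity 3 are the cubic monomials not
  divisible by \<open>w v\<close>. The 20 consequences are the products of \<open>R(t, w, z)\<close>, \<open>R(t, x, v)\<close>,
  \<open>R(w, x, y)\<close>, \<open>R(v, y, z)\<close> with \<open>x, y, z, t\<close>, and with \<open>w\<close> for the first and third and \<open>v\<close> for the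
  second and fourth. Hence the kernel of the transposed matrix of consequences is the space of
  identities between polynomials

    \<open>A\<^sub>1 R(t, w, z) + A\<^sub>2 R(t, x, v) + A\<^sub>3 R(w, x, y) + A\<^sub>4 R(v, y, z) = 0\<close>    \<open>(E)\<close>

  with linear forms \<open>A\<^sub>1, A\<^sub>3\<close> in \<open>x, y, z, t, w\<close> and \<open>A\<^sub>2, A\<^sub>4\<close> in \<open>x, y, z, t, v\<close>, and the rank is 20 minus
  the dimension of this space. Comparing coefficients in \<open>(E)\<close> gives 50 very sparse equations
  (\<open>syzygy_iff\<close>) in the 20 coefficients of the \<open>A\<^sub>i\<close>.

  If \<open>R\<close> is a form in \<open>s\<^sup>2, p\<^sup>2, q\<^sup>2\<close> alone, then \<open>w\<close> and \<open>v\<close> do not occur in the solutions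
  \<open>A\<^sub>i\<close> of \<open>(E)\<close>, and \<open>(E)\<close> decouples into one and the same system with constant coefficients for each
  of the variables \<open>x, y, z, t\<close>. This system has a nonzero solution exactly for the forms
  \<open>s\<^sup>2 - p\<^sup>2 - q\<^sup>2\<close>, \<open>s\<^sup>2 - p\<^sup>2\<close>, \<open>s\<^sup>2 - q\<^sup>2\<close>, \<open>s\<^sup>2\<close>, \<open>p\<^sup>2\<close>, \<open>q\<^sup>2\<close> up to a factor, and the solution
  is then unique up to a factor, whence nullity 4 and rank 16 (\<open>rank16_identity_if_syzygy\<close>,
  \<open>rank16_identity_nullity\<close>).

  Otherwise \<open>b\<close>, \<open>d\<close> or \<open>e\<close> is nonzero. Exchanging left and right exchanges \<open>b\<close> with \<open>d\<close> and \<open>c\<close> with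
  \<open>f\<close>, so it suffices to treat \<open>b = 1\<close> after rescaling, and \<open>b = d = 0 \<noteq> e\<close>. For \<open>b = 1\<close>, fifteen of the
  coefficients are expressed through the remaining five, and a few further equations determine the
  admissible parameters, according to whether the coefficient of \<open>x\<close> in \<open>A\<^sub>1\<close> vanishes
  (\<open>parameters_if_u0_nonzero\<close>, \<open>parameters_if_u0_zero\<close>). The result is the second list of identities; for
  each of them \<open>(E)\<close> has one solution up to a factor, which gives nullity 1 and rank 19
  (\<open>rank19_identity_nullity\<close>). In all other cases \<open>(E)\<close> has only the trivial solution.
\<close>

section \<open>The rank in terms of free coordinates of the kernel\<close>

lemma lincomb_cols_eq_mult_mat_vec:
  fixes A :: "'a::field mat"
  assumes A: "A \<in> carrier_mat m n" and Q: "Q \<subseteq> {..<n}" "inj_on (col A) Q"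
    and v: "v \<in> carrier_vec n" "\<And>i. i < n \<Longrightarrow> i \<notin> Q \<Longrightarrow> v $ i = 0"
    and g: "\<And>i. i \<in> Q \<Longrightarrow> g (col A i) = v $ i"
  shows "module.lincomb (module_vec TYPE('a) m) g (col A ` Q) = A *\<^sub>v v"
proof -
  interpret vec_space "TYPE('a)" m .
  have cols: "col A ` Q \<subseteq> carrier_vec m"
    using A by auto
  show ?thesis
  proof (rule eq_vecI)
    fix k assume "k < dim_vec (A *\<^sub>v v)"
    then have k: "k < m" using A by simp
    have "lincomb g (col A ` Q) $ k = (\<Sum>x\<in>col A ` Q. g x * x $ k)"
      by (rule lincomb_index[OF k cols])
    also have "\<dots> = (\<Sum>i\<in>Q. v $ i * A $$ (k, i))"
      using A Q k g by (subst sum.reindex) (auto intro!: sum.cong)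
    also have "\<dots> = (\<Sum>i<n. v $ i * A $$ (k, i))"
      using Q v by (intro sum.mono_neutral_left) auto
    also have "\<dots> = (A *\<^sub>v v) $ k"
      using A v k by (auto simp: scalar_prod_def mult.commute atLeast0LessThan intro!: sum.cong)
    finally show "lincomb g (col A ` Q) $ k = (A *\<^sub>v v) $ k" .
  qed (use A cols lincomb_dim[OF _ cols] Q finite_subset in auto)
qed

text \<open>
  If the coordinates in \<open>F\<close> can be prescribed arbitrarily on the kernel and determine its elements,
  then the columns outside \<open>F\<close> form a basis of the column space: determinacy makes them independent,
  and the kernel vectors with a single nonzero coordinate in \<open>F\<close> express the other columns through them.
\<close>

lemma mat_rank_by_free_coordinates:
  fixes A :: "'a::field mat"
  assumes A: "A \<in> carrier_mat m n" and F: "F \<subseteq> {..<n}"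
    and determined: "\<And>v. v \<in> carrier_vec n \<Longrightarrow> A *\<^sub>v v = 0\<^sub>v m \<Longrightarrow> \<forall>j\<in>F. v $ j = 0 \<Longrightarrow> v = 0\<^sub>v n"
    and free: "\<And>j. j \<in> F \<Longrightarrow>
      \<exists>v\<in>carrier_vec n. A *\<^sub>v v = 0\<^sub>v m \<and> v $ j = 1 \<and> (\<forall>i\<in>F - {j}. v $ i = 0)"
  shows "mat_rank A = n - card F"
proof -
  interpret vec_space "TYPE('a)" m .
  define P where "P = {..<n} - F"
  have P: "P \<subseteq> {..<n}" "finite P" by (auto simp: P_def)
  have cols: "col A ` Q \<subseteq> carrier_vec m" if "Q \<subseteq> {..<n}" for Q
    using A that by auto
  have inj: "inj_on (col A) P"
  proof (rule inj_onI, rule ccontr)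
    fix i j assume ij: "i \<in> P" "j \<in> P" "col A i = col A j" "i \<noteq> j"
    have unit: "A *\<^sub>v unit_vec n l = col A l" if "l < n" for l
      using A that by (intro eq_vecI) auto
    let ?v = "unit_vec n i - unit_vec n j :: 'a vec"
    have "A *\<^sub>v ?v = col A i - col A j"
      using A ij by (subst mult_minus_distrib_mat_vec[of _ m n]) (auto simp: unit P_def)
    also have "\<dots> = 0\<^sub>v m" using ij A by auto
    finally have "?v = 0\<^sub>v n"
      using ij P F by (intro determined) (auto simp: P_def)
    then have "?v $ i = 0\<^sub>v n $ i" by simp
    then show False using ij by (simp add: P_def)
  qed
  have indpt: "lin_indpt (col A ` P)"
  proof
    assume "lin_dep (col A ` P)"
    then obtain g w where g: "lincomb g (col A ` P) = 0\<^sub>v m" "w \<in> col A ` P" "g w \<noteq> 0"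
      using finite_lin_dep[of "col A ` P"] cols[OF P(1)] P(2) by auto
    define v where "v = vec n (\<lambda>i. if i \<in> P then g (col A i) else 0)"
    have "lincomb g (col A ` P) = A *\<^sub>v v"
      using A P inj by (intro lincomb_cols_eq_mult_mat_vec) (auto simp: v_def)
    then have "v = 0\<^sub>v n"
      using g F by (intro determined) (auto simp: v_def P_def)
    moreover obtain i where "i \<in> P" "w = col A i" using g by auto
    ultimately show False
      using g P by (auto simp: v_def vec_eq_iff)
  qed
  have "maximal (col A ` P) (\<lambda>T. T \<subseteq> set (cols A) \<and> lin_indpt T)"
    unfolding maximal_def
  proof (intro conjI allI impI)
    show "col A ` P \<subseteq> set (cols A)"
      using A P by (auto simp: cols_def)
  next
    fix T assume T: "col A ` P \<subseteq> T \<and> T \<subseteq> set (cols A) \<and> lin_indpt T"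
    have "c \<in> col A ` P" if "c \<in> T" for c
    proof (rule ccontr)
      assume c: "c \<notin> col A ` P"
      from \<open>c \<in> T\<close> T obtain j where j: "j < n" "c = col A j"
        using A by (auto simp: cols_def)
      with c have "j \<in> F" by (auto simp: P_def)
      from free[OF this] obtain v where v: "v \<in> carrier_vec n" "A *\<^sub>v v = 0\<^sub>v m" "v $ j = 1"
        "\<forall>i\<in>F - {j}. v $ i = 0" by auto
      let ?Q = "insert j P"
      let ?g = "\<lambda>x. v $ inv_into ?Q (col A) x"
      have inj': "inj_on (col A) ?Q" using inj c j by auto
      have "lincomb ?g (col A ` ?Q) = A *\<^sub>v v"
        using A P inj' j v by (intro lincomb_cols_eq_mult_mat_vec) (auto simp: P_def)
      then have zero: "lincomb ?g (col A ` ?Q) = 0\<^sub>v m"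
        using v by simp
      have "?g c \<noteq> 0" using v inj' j by simp
      then have "lin_dep T"
        using T \<open>c \<in> T\<close> P j by (intro lin_dep_crit[OF _ _ _ _ _ zero, of _ c]) auto
      with T show False by simp
    qed
    with T show "T = col A ` P" by auto
  qed (fact indpt)
  from rank_card_indpt[OF A this] have "rank A = card P"
    using inj by (simp add: card_image)
  also have "\<dots> = n - card F"
    using F by (simp add: P_def card_Diff_subset finite_subset)
  finally show ?thesis
    using A by (simp add: mat_rank_def)
qed

section \<open>Linear extension of the compositions\<close>

lemma lookup_scal [simp]: "Poly_Mapping.lookup (c \<cdot> R) w = c * Poly_Mapping.lookup R w"
  by (simp add: scal_def map.rep_eq when_def)

lemma scal_add: "c \<cdot> (R + S) = c \<cdot> R + c \<cdot> S"
  by (rule poly_mapping_eqI) (simp add: lookup_add algebra_simps)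

lemma scal_add_left: "(c + k) \<cdot> R = c \<cdot> R + k \<cdot> R"
  by (rule poly_mapping_eqI) (simp add: lookup_add algebra_simps)

lemma scal_scal: "c \<cdot> k \<cdot> R = (c * k) \<cdot> R"
  by (rule poly_mapping_eqI) simp

lemma scal_one [simp]: "1 \<cdot> R = R"
  by (rule poly_mapping_eqI) simp

lemma scal_zero_iff: "k \<noteq> 0 \<Longrightarrow> k \<cdot> R = 0 \<longleftrightarrow> R = 0"
  by (auto simp: poly_mapping_eq_iff fun_eq_iff)

lemma lin_superset:
  assumes "finite K" "Poly_Mapping.keys R \<subseteq> K"
  shows "lin \<phi> R = (\<Sum>m\<in>K. Poly_Mapping.single (\<phi> m) (Poly_Mapping.lookup R m))"
  unfolding lin_def using assms
  by (intro sum.mono_neutral_left) (auto simp: in_keys_iff)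

lemma lin_add: "lin \<phi> (R + S) = lin \<phi> R + lin \<phi> S"
proof -
  let ?K = "Poly_Mapping.keys R \<union> Poly_Mapping.keys S"
  have "Poly_Mapping.keys (R + S) \<subseteq> ?K" by (rule Poly_Mapping.keys_add)
  then show ?thesis
    by (simp add: lin_superset[of ?K] lookup_add single_add sum.distrib)
qed

lemma lin_scal: "lin \<phi> (k \<cdot> R) = k \<cdot> lin \<phi> R"
proof -
  have "Poly_Mapping.keys (k \<cdot> R) \<subseteq> Poly_Mapping.keys R"
    by (auto simp: in_keys_iff)
  then have "lin \<phi> (k \<cdot> R) =
      (\<Sum>m\<in>Poly_Mapping.keys R. Poly_Mapping.single (\<phi> m) (k * Poly_Mapping.lookup R m))"
    by (simp add: lin_superset[of "Poly_Mapping.keys R"])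
  also have "\<dots> = k \<cdot> lin \<phi> R"
    by (rule poly_mapping_eqI) (simp add: lin_def lookup_sum lookup_single when_def sum_distrib_left
      if_distrib cong: if_cong)
  finally show ?thesis .
qed

lemma lin_scal_bas: "lin \<phi> (c \<cdot> bas m) = c \<cdot> bas (\<phi> m)"
proof -
  have "Poly_Mapping.keys (c \<cdot> bas m) \<subseteq> {m}"
    by (auto simp: in_keys_iff lookup_single when_def split: if_splits)
  then have "lin \<phi> (c \<cdot> bas m) = Poly_Mapping.single (\<phi> m) c"
    by (simp add: lin_superset[of "{m}"])
  also have "\<dots> = c \<cdot> bas (\<phi> m)"
    by (rule poly_mapping_eqI) (simp add: lookup_single when_def)
  finally show ?thesis .
qed

section \<open>Linear relations among the consequences\<close>

definition op_identity :: "'a::field \<Rightarrow> 'a \<Rightarrow> 'a \<Rightarrow> 'a \<Rightarrow> 'a \<Rightarrow> 'a \<Rightarrow> opword \<Rightarrow>\<^sub>0 'a"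
  where "op_identity a b c d e f =
    a \<cdot> bas (L2 (X \<diamondop> Y)) + b \<cdot> bas (L (L X \<diamondop> Y)) + c \<cdot> bas (L2 X \<diamondop> Y)
      + d \<cdot> bas (L (X \<diamondop> L Y)) + e \<cdot> bas (L X \<diamondop> L Y) + f \<cdot> bas (X \<diamondop> L2 Y)"

lemma length_consequences [simp]: "length (consequences R) = 20"
  by (simp add: consequences_def)

text \<open>
  By the order in which the consequences are listed, \<open>u\<close> encodes the linear forms

  \<open>A\<^sub>1 = u\<^sub>0 x + u\<^sub>1 y + u\<^sub>2 z + u\<^sub>1\<^sub>2 t + u\<^sub>1\<^sub>6 w\<close>, \<open>A\<^sub>2 = u\<^sub>3 x + u\<^sub>4 y + u\<^sub>5 z + u\<^sub>1\<^sub>3 t + u\<^sub>1\<^sub>7 v\<close>,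

  \<open>A\<^sub>3 = u\<^sub>6 x + u\<^sub>7 y + u\<^sub>8 z + u\<^sub>1\<^sub>4 t + u\<^sub>1\<^sub>8 w\<close>, \<open>A\<^sub>4 = u\<^sub>9 x + u\<^sub>1\<^sub>0 y + u\<^sub>1\<^sub>1 z + u\<^sub>1\<^sub>5 t + u\<^sub>1\<^sub>9 v\<close>.
\<close>

definition syzygy :: "(opword \<Rightarrow>\<^sub>0 'a::field) \<Rightarrow> (nat \<Rightarrow> 'a) \<Rightarrow> bool"
  where "syzygy R u \<longleftrightarrow> (\<Sum>i<20. u i \<cdot> (consequences R ! i)) = 0"

lemma syzygy_cong: "(\<And>i. i < 20 \<Longrightarrow> u i = v i) \<Longrightarrow> syzygy R u \<longleftrightarrow> syzygy R v"
  by (simp add: syzygy_def)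

abbreviation Z :: opword where "Z \<equiv> arg 3"

text \<open>
  The left-hand side of \<open>(E)\<close>, as the list of its monomials with their coefficients.
\<close>

definition combination_coeffs :: "'a::field \<Rightarrow> 'a \<Rightarrow> 'a \<Rightarrow> 'a \<Rightarrow> 'a \<Rightarrow> 'a \<Rightarrow> (nat \<Rightarrow> 'a)
    \<Rightarrow> (opword \<times> 'a) list"
  where "combination_coeffs a b c d e f u =
   [(L2 (L X \<diamondop> Y \<diamondop> Z), a * u 0 + a * u 3 + b * u 13),
    (L (L (L X \<diamondop> Y) \<diamondop> Z), b * u 0 + b * u 14),
    (L2 (L X \<diamondop> Y) \<diamondop> Z, c * u 0 + a * u 6 + b * u 18),
    (L (L X \<diamondop> Y \<diamondop> L Z), d * u 0 + b * u 5),
    (L (L X \<diamondop> Y) \<diamondop> L Z, e * u 0 + b * u 8),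
    (L X \<diamondop> Y \<diamondop> L2 Z, f * u 0 + f * u 9),
    (L2 (X \<diamondop> L Y \<diamondop> Z), a * u 1 + a * u 4),
    (L (L (X \<diamondop> L Y) \<diamondop> Z), b * u 1 + d * u 14),
    (L2 (X \<diamondop> L Y) \<diamondop> Z, c * u 1 + a * u 7 + d * u 18),
    (L (X \<diamondop> L Y \<diamondop> L Z), d * u 1 + e * u 15),
    (L (X \<diamondop> L Y) \<diamondop> L Z, e * u 1 + d * u 8),
    (X \<diamondop> L Y \<diamondop> L2 Z, f * u 1 + f * u 10 + e * u 11),
    (L2 (X \<diamondop> Y \<diamondop> L Z), a * u 2 + a * u 5 + d * u 12),
    (L (L (X \<diamondop> Y) \<diamondop> L Z), b * u 2 + e * u 12 + d * u 16),
    (L2 (X \<diamondop> Y) \<diamondop> L Z, c * u 2 + a * u 8 + e * u 16),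
    (L (X \<diamondop> Y \<diamondop> L2 Z), d * u 2 + f * u 12 + f * u 15),
    (L (X \<diamondop> Y) \<diamondop> L2 Z, e * u 2 + f * u 16),
    (X \<diamondop> Y \<diamondop> L (L2 Z), f * u 2 + f * u 11),
    (L (L2 X \<diamondop> Y \<diamondop> Z), b * u 3 + c * u 13 + c * u 14),
    (L (L2 X) \<diamondop> Y \<diamondop> Z, c * u 3 + c * u 6),
    (L (L X \<diamondop> L (Y \<diamondop> Z)), d * u 3 + e * u 13 + b * u 17),
    (L2 X \<diamondop> L (Y \<diamondop> Z), e * u 3 + c * u 17),
    (L X \<diamondop> L2 (Y \<diamondop> Z), f * u 3 + a * u 9 + e * u 17),
    (L (L X \<diamondop> L Y \<diamondop> Z), b * u 4 + e * u 14),
    (L2 X \<diamondop> L Y \<diamondop> Z, c * u 4 + e * u 6 + c * u 7),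
    (L (X \<diamondop> L (L Y \<diamondop> Z)), d * u 4 + b * u 15),
    (L X \<diamondop> L (L Y \<diamondop> Z), e * u 4 + b * u 9),
    (X \<diamondop> L2 (L Y \<diamondop> Z), f * u 4 + a * u 10 + b * u 19),
    (L2 X \<diamondop> Y \<diamondop> L Z, c * u 5 + c * u 8),
    (L (X \<diamondop> L (Y \<diamondop> L Z)), d * u 5 + d * u 15),
    (L X \<diamondop> L (Y \<diamondop> L Z), e * u 5 + d * u 9),
    (X \<diamondop> L2 (Y \<diamondop> L Z), f * u 5 + a * u 11 + d * u 19),
    (L (L2 X \<diamondop> Y) \<diamondop> Z, b * u 6 + c * u 18),
    (L (L X \<diamondop> L Y) \<diamondop> Z, d * u 6 + b * u 7 + e * u 18),
    (L X \<diamondop> L2 Y \<diamondop> Z, f * u 6 + e * u 7 + c * u 9),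
    (L (X \<diamondop> L2 Y) \<diamondop> Z, d * u 7 + f * u 18),
    (X \<diamondop> L (L2 Y) \<diamondop> Z, f * u 7 + c * u 10),
    (L X \<diamondop> L Y \<diamondop> L Z, e * u 8 + e * u 9),
    (X \<diamondop> L2 Y \<diamondop> L Z, f * u 8 + e * u 10 + c * u 11),
    (X \<diamondop> L (L2 Y \<diamondop> Z), b * u 10 + c * u 19),
    (X \<diamondop> L (L Y \<diamondop> L Z), d * u 10 + b * u 11 + e * u 19),
    (X \<diamondop> L (Y \<diamondop> L2 Z), d * u 11 + f * u 19),
    (L (L2 (X \<diamondop> Y \<diamondop> Z)), a * u 12 + a * u 13),
    (L2 (L (X \<diamondop> Y) \<diamondop> Z), b * u 12 + a * u 16),
    (L (L2 (X \<diamondop> Y) \<diamondop> Z), c * u 12 + a * u 14 + b * u 16),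
    (L2 (X \<diamondop> L (Y \<diamondop> Z)), d * u 13 + a * u 17),
    (L (X \<diamondop> L2 (Y \<diamondop> Z)), f * u 13 + a * u 15 + d * u 17),
    (L (X \<diamondop> L2 Y \<diamondop> Z), f * u 14 + c * u 15),
    (L (L2 (X \<diamondop> Y)) \<diamondop> Z, c * u 16 + a * u 18),
    (X \<diamondop> L (L2 (Y \<diamondop> Z)), f * u 17 + a * u 19)]"

lemmas word_simps = comp_B_def B_comp_def comp_L_def opdegree_def L_def prd_def arg_def

lemma opmonomial_simps:
  "opmonomial [Arg i]"
  "opmonomial u \<Longrightarrow> opmonomial [Op u]"
  "opmonomial [g] \<Longrightarrow> opmonomial (h # w) \<Longrightarrow> opmonomial (g # h # w)"
  using opmonomial.intros(1)[of i] opmonomial.intros(2)[of u] opmonomial.intros(3)[of "[g]" "h # w"]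
  by (simp_all add: arg_def L_def prd_def)

lemma fst_coeffs: "distinct (map fst (combination_coeffs a b c d e f u))"
   "set (map fst (combination_coeffs a b c d e f u)) \<subseteq> opmonomials 3 3"
  by (simp_all add: combination_coeffs_def word_simps opmonomials_def opmonomial_simps upt_conv_Cons)

lemma sum_lessThan_20: "(\<Sum>i<20. g i) = g 0 + g 1 + g 2 + g 3 + g 4 + g 5 + g 6 + g 7 + g 8 + g 9
   + g 10 + g 11 + g 12 + g 13 + g 14 + g 15 + g 16 + g 17 + g 18 + g (19::nat)"
  for g :: "nat \<Rightarrow> 'b::comm_monoid_add"
  by (simp add: eval_nat_numeral)

lemma combination_eq:
  "(\<Sum>i<20. u i \<cdot> (consequences (op_identity a b c d e f) ! i)) =
    (\<Sum>(w, x)\<leftarrow>combination_coeffs a b c d e f u. x \<cdot> bas w)"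
  by (simp add: sum_lessThan_20 consequences_def op_identity_def lin_add lin_scal_bas word_simps
        cong: if_cong,
      simp add: combination_coeffs_def word_simps scal_add scal_scal scal_add_left mult.commute,
      simp add: add_ac numeral_2_eq_2 numeral_3_eq_3)

lemma lookup_sum_list_bas:
  assumes "distinct (map fst ps)" "(w, x) \<in> set ps"
  shows "Poly_Mapping.lookup (\<Sum>(v, y)\<leftarrow>ps. y \<cdot> bas v) w = x"
proof -
  have zero: "Poly_Mapping.lookup (\<Sum>(v, y)\<leftarrow>qs. y \<cdot> bas v) w = 0" if "w \<notin> fst ` set qs" for qs
    using that by (induction qs) (auto simp: lookup_add lookup_single when_def)
  show ?thesis
    using assms
  proof (induction ps)
    case (Cons p ps)
    then show ?case
      using zero[of ps] by (cases p) (auto simp: lookup_add lookup_single when_def rev_image_eqI)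
  qed simp
qed

lemma syzygy_iff_coeffs:
  "syzygy (op_identity a b c d e f) u \<longleftrightarrow> list_all (\<lambda>(w, x). x = 0) (combination_coeffs a b c d e f u)"
  (is "_ \<longleftrightarrow> list_all _ ?ps")
proof
  assume "syzygy (op_identity a b c d e f) u"
  then have "(\<Sum>(v, y)\<leftarrow>?ps. y \<cdot> bas v) = 0"
    by (simp add: syzygy_def combination_eq)
  then show "list_all (\<lambda>(w, x). x = 0) ?ps"
    using lookup_sum_list_bas[OF fst_coeffs(1)] by (fastforce simp: list_all_iff)
next
  assume *: "list_all (\<lambda>(w, x). x = 0) ?ps"
  have "(\<Sum>(v, y)\<leftarrow>qs. y \<cdot> bas v) = 0" if "list_all (\<lambda>(w, x). x = 0) qs" for qs :: "(opword \<times> 'a) list"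
    using that by (induction qs) (auto intro!: poly_mapping_eqI)
  from this[OF *] show "syzygy (op_identity a b c d e f) u"
    by (simp add: syzygy_def combination_eq)
qed

text \<open>
  The 50 equations in the order of the list, with no simplification applied, so that each of them can
  be picked out in the form in which it appears there.
\<close>

lemmas syzygy_iff = syzygy_iff_coeffs[unfolded combination_coeffs_def list.pred_inject prod.case simp_thms]

text \<open>
  The entries of the product are the coefficients of the combination of consequences at the monomials in
  \<open>bs\<close>, and all monomials of this combination are among those.
\<close>

lemma kernel_iff_syzygy:
  fixes v :: "'a::field vec"
  assumes R: "R = op_identity a b c d e f" and bs: "set bs = opmonomials 3 3"
    and v: "v \<in> carrier_vec 20"
  shows "transpose_mat (consequence_matrix bs R) *\<^sub>v v = 0\<^sub>v (length bs) \<longleftrightarrow> syzygy R (\<lambda>i. v $ i)"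
proof -
  define S where "S = (\<Sum>i<20. v $ i \<cdot> (consequences R ! i))"
  have entry: "(transpose_mat (consequence_matrix bs R) *\<^sub>v v) $ j = Poly_Mapping.lookup S (bs ! j)"
    if "j < length bs" for j
    using that v by (auto simp: S_def consequence_matrix_def scalar_prod_def lookup_sum atLeast0LessThan
        mult.commute intro!: sum.cong)
  have "syzygy R (\<lambda>i. v $ i)" if "\<And>j. j < length bs \<Longrightarrow> Poly_Mapping.lookup S (bs ! j) = 0"
    unfolding R syzygy_iff_coeffs list_all_iff
  proof clarify
    fix w x assume wx: "(w, x) \<in> set (combination_coeffs a b c d e f (\<lambda>i. v $ i))"
    then have "w \<in> set bs"
      using fst_coeffs(2)[of a b c d e f "\<lambda>i. v $ i"] bs by force
    then obtain j where "j < length bs" "w = bs ! j"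
      by (auto simp: in_set_conv_nth)
    with that have "Poly_Mapping.lookup S w = 0" by simp
    then show "x = 0"
      using lookup_sum_list_bas[OF fst_coeffs(1) wx] by (simp add: S_def R combination_eq)
  qed
  moreover have "S = 0" if "syzygy R (\<lambda>i. v $ i)"
    using that by (simp add: syzygy_def S_def)
  moreover have "dim_vec (transpose_mat (consequence_matrix bs R) *\<^sub>v v) = length bs"
    by (simp add: consequence_matrix_def)
  ultimately show ?thesis
    using entry by (auto simp: vec_eq_iff)
qed

definition free_coordinates :: "(opword \<Rightarrow>\<^sub>0 'a::field) \<Rightarrow> nat set \<Rightarrow> bool"
  where "free_coordinates R F \<longleftrightarrow> F \<subseteq> {..<20}
    \<and> (\<forall>u. syzygy R u \<and> (\<forall>j\<in>F. u j = 0) \<longrightarrow> (\<forall>i<20. u i = 0))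
    \<and> (\<forall>j\<in>F. \<exists>u. syzygy R u \<and> u j = 1 \<and> (\<forall>i\<in>F - {j}. u i = 0))"

lemma mat_rank_free_coordinates:
  fixes R :: "opword \<Rightarrow>\<^sub>0 'a::field"
  assumes R: "R = op_identity a b c d e f" and bs: "set bs = opmonomials 3 3"
    and F: "free_coordinates R F"
  shows "mat_rank (transpose_mat (consequence_matrix bs R)) = 20 - card F"
proof (rule mat_rank_by_free_coordinates)
  show "transpose_mat (consequence_matrix bs R) \<in> carrier_mat (length bs) 20"
    by (simp add: consequence_matrix_def)
  show "F \<subseteq> {..<20}" using F by (simp add: free_coordinates_def)
next
  fix v :: "'a vec"
  assume "v \<in> carrier_vec 20" "transpose_mat (consequence_matrix bs R) *\<^sub>v v = 0\<^sub>v (length bs)"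
    "\<forall>j\<in>F. v $ j = 0"
  then show "v = 0\<^sub>v 20"
    using F kernel_iff_syzygy[OF R bs] by (auto simp: free_coordinates_def vec_eq_iff)
next
  fix j assume "j \<in> F"
  with F obtain u where u: "syzygy R u" "u j = 1" "\<forall>i\<in>F - {j}. u i = 0" and F20: "F \<subseteq> {..<20}"
    by (auto simp: free_coordinates_def)
  then have "syzygy R (\<lambda>i. vec 20 u $ i)"
    using syzygy_cong[of u "\<lambda>i. vec 20 u $ i" R] by simp
  moreover have "vec 20 u $ i = u i" if "i \<in> F" for i
    using F20 that by auto
  ultimately show "\<exists>v\<in>carrier_vec 20. transpose_mat (consequence_matrix bs R) *\<^sub>v v = 0\<^sub>v (length bs)
      \<and> v $ j = 1 \<and> (\<forall>i\<in>F - {j}. v $ i = 0)"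
    using u \<open>j \<in> F\<close> kernel_iff_syzygy[OF R bs, of "vec 20 u"]
    by (intro bexI[of _ "vec 20 u"]) auto
qed

lemma free_coordinate_singletonI:
  assumes "j < 20" "syzygy R u" "u j = 1"
    and "\<And>u. syzygy R u \<Longrightarrow> u j = 0 \<Longrightarrow> \<forall>i<20. u i = 0"
  shows "free_coordinates R {j}"
  using assms by (auto simp: free_coordinates_def)

lemma all_lessThan_20: "(\<forall>i<20. P i) \<longleftrightarrow> P 0 \<and> P 1 \<and> P 2 \<and> P 3 \<and> P 4 \<and> P 5 \<and> P 6 \<and> P 7 \<and> P 8 \<and> P 9
   \<and> P 10 \<and> P 11 \<and> P 12 \<and> P 13 \<and> P 14 \<and> P 15 \<and> P 16 \<and> P 17 \<and> P 18 \<and> P (19::nat)"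
  by (auto simp: eval_nat_numeral All_less_Suc)

section \<open>Rescaling, coordinates and reversal\<close>

lemma proportional_refl: "R \<propto> R"
  unfolding proportional_def by (intro exI[of _ 1]) simp

lemma proportional_trans: "R \<propto> S \<Longrightarrow> S \<propto> T \<Longrightarrow> R \<propto> T"
  unfolding proportional_def by (metis scal_scal mult_eq_0_iff)

lemma consequences_scal: "consequences (k \<cdot> R) = map (\<lambda>S. k \<cdot> S) (consequences R)"
  by (simp add: consequences_def lin_scal)

lemma syzygy_proportional:
  assumes "R \<propto> S"
  shows "syzygy R = syzygy S"
proof
  fix u
  from assms obtain k where k: "k \<noteq> 0" "R = k \<cdot> S" by (auto simp: proportional_def)
  have "(\<Sum>i<20. u i \<cdot> (consequences R ! i)) = k \<cdot> (\<Sum>i<20. u i \<cdot> (consequences S ! i))"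
    by (rule poly_mapping_eqI)
       (simp add: k(2) consequences_scal lookup_sum sum_distrib_left mult.left_commute)
  then show "syzygy R u \<longleftrightarrow> syzygy S u"
    using k by (simp add: syzygy_def scal_zero_iff)
qed

lemma free_coordinates_proportional:
  "R \<propto> S \<Longrightarrow> free_coordinates R F \<longleftrightarrow> free_coordinates S F"
  by (simp add: free_coordinates_def syzygy_proportional)

lemma scal_op_identity: "k \<cdot> op_identity a b c d e f = op_identity (k * a) (k * b) (k * c) (k * d) (k * e) (k * f)"
  by (simp add: op_identity_def scal_add scal_scal)

lemma op_identity_inject [simp]:
  "op_identity a b c d e f = op_identity a' b' c' d' e' f' \<longleftrightarrow>
     a = a' \<and> b = b' \<and> c = c' \<and> d = d' \<and> e = e' \<and> f = f'"
proof
  assume *: "op_identity a b c d e f = op_identity a' b' c' d' e' f'"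
  have "Poly_Mapping.lookup (op_identity a b c d e f) w = Poly_Mapping.lookup (op_identity a' b' c' d' e' f') w" for w
    by (simp add: *)
  from this[of "L2 (X \<diamondop> Y)"] this[of "L (L X \<diamondop> Y)"] this[of "L2 X \<diamondop> Y"] this[of "L (X \<diamondop> L Y)"]
    this[of "L X \<diamondop> L Y"] this[of "X \<diamondop> L2 Y"]
  show "a = a' \<and> b = b' \<and> c = c' \<and> d = d' \<and> e = e' \<and> f = f'"
    by (simp add: op_identity_def word_simps lookup_add lookup_single)
qed simp

lemma proportional_op_identity:
  "op_identity a b c d e f \<propto> op_identity a' b' c' d' e' f' \<longleftrightarrow>
    (\<exists>k. k \<noteq> 0 \<and> a = k * a' \<and> b = k * b' \<and> c = k * c' \<and> d = k * d' \<and> e = k * e' \<and> f = k * f')"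
  by (simp add: proportional_def scal_op_identity)

lemma op_identity_add: "op_identity a b c d e f + op_identity a' b' c' d' e' f' =
    op_identity (a + a') (b + b') (c + c') (d + d') (e + e') (f + f')"
  by (rule poly_mapping_eqI) (simp add: op_identity_def lookup_add algebra_simps)

lemma op_identity_diff: "op_identity a b c d e f - op_identity a' b' c' d' e' f' =
    op_identity (a - a') (b - b') (c - c') (d - d') (e - e') (f - f')"
  by (rule poly_mapping_eqI) (simp add: op_identity_def lookup_add lookup_minus algebra_simps)

lemma bas_op_identity:
  "bas (L2 (X \<diamondop> Y)) = op_identity 1 0 0 0 0 0" "bas (L (L X \<diamondop> Y)) = op_identity 0 1 0 0 0 0"
  "bas (L2 X \<diamondop> Y) = op_identity 0 0 1 0 0 0" "bas (L (X \<diamondop> L Y)) = op_identity 0 0 0 1 0 0"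
  "bas (L X \<diamondop> L Y) = op_identity 0 0 0 0 1 0" "bas (X \<diamondop> L2 Y) = op_identity 0 0 0 0 0 1"
  by (auto intro!: poly_mapping_eqI simp: op_identity_def lookup_add)

lemmas op_identity_arith = bas_op_identity op_identity_add op_identity_diff scal_op_identity

lemma rank16_identity_iff:
  "rank16_identity R \<longleftrightarrow> R \<propto> op_identity 1 0 (- 1) 0 0 (- 1) \<or> R \<propto> op_identity 1 0 (- 1) 0 0 0
    \<or> R \<propto> op_identity 1 0 0 0 0 (- 1) \<or> R \<propto> op_identity 1 0 0 0 0 0
    \<or> R \<propto> op_identity 0 0 1 0 0 0 \<or> R \<propto> op_identity 0 0 0 0 0 1"
  unfolding rank16_identity_def op_identity_arith by simp

lemma rank19_identity_iff:
  "rank19_identity R \<longleftrightarrow> R \<propto> op_identity 1 0 0 1 0 1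
    \<or> (\<exists>\<delta>. \<delta> \<noteq> 0 \<and> R \<propto> op_identity 1 0 0 \<delta> 0 (- (\<delta> + 1)))
    \<or> R \<propto> op_identity 1 1 1 0 0 0
    \<or> (\<exists>\<beta>. \<beta> \<noteq> 0 \<and> R \<propto> op_identity 1 \<beta> (- (\<beta> + 1)) 0 0 0)
    \<or> R \<propto> op_identity 1 (- 2) 1 (- 2) 2 1
    \<or> R \<propto> op_identity 1 (- 1) 0 (- 1) 1 0
    \<or> R \<propto> op_identity 0 1 (- 1) 0 0 0
    \<or> R \<propto> op_identity 0 1 0 0 (- 1) 0
    \<or> R \<propto> op_identity 0 1 0 0 0 0
    \<or> R \<propto> op_identity 0 1 0 1 (- 1) 0
    \<or> R \<propto> op_identity 0 0 0 1 (- 1) 0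
    \<or> R \<propto> op_identity 0 0 0 1 0 (- 1)
    \<or> R \<propto> op_identity 0 0 0 1 0 0
    \<or> R \<propto> op_identity 0 0 0 0 1 0"
  unfolding rank19_identity_def op_identity_arith by simp

text \<open>
  Reading all words from right to left exchanges \<open>p\<close> with \<open>q\<close>, \<open>x\<close> with \<open>z\<close> and \<open>w\<close> with \<open>v\<close>, hence
  \<open>R(t, w, z)\<close> with \<open>R(t, x, v)\<close> and \<open>R(w, x, y)\<close> with \<open>R(v, y, z)\<close>. This is the induced permutation of
  the consequences.
\<close>

definition mirror :: "nat \<Rightarrow> nat"
  where "mirror i = [5, 4, 3, 2, 1, 0, 11, 10, 9, 8, 7, 6, 13, 12, 15, 14, 17, 16, 19, 18] ! i"

lemma mirror_lessThan: "i < 20 \<Longrightarrow> mirror i < 20" "i < 20 \<Longrightarrow> mirror (mirror i) = i"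
proof -
  have "\<forall>i<20. mirror i < 20 \<and> mirror (mirror i) = i"
    by (simp add: all_lessThan_20 mirror_def)
  then show "i < 20 \<Longrightarrow> mirror i < 20" "i < 20 \<Longrightarrow> mirror (mirror i) = i" by auto
qed

lemma syzygy_mirror:
  "syzygy (op_identity a b c d e f) u \<Longrightarrow> syzygy (op_identity a d f b e c) (\<lambda>i. u (mirror i))"
  unfolding syzygy_iff by (simp add: mirror_def add_ac)

lemma free_coordinates_mirror:
  assumes F: "free_coordinates (op_identity a b c d e f) F"
  shows "free_coordinates (op_identity a d f b e c) (mirror ` F)"
  unfolding free_coordinates_def
proof (intro conjI allI impI ballI)
  have F20: "F \<subseteq> {..<20}" using F by (simp add: free_coordinates_def)
  then show "mirror ` F \<subseteq> {..<20}" using mirror_lessThan by auto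
  fix u and i :: nat assume u: "syzygy (op_identity a d f b e c) u \<and> (\<forall>j\<in>mirror ` F. u j = 0)" and "i < 20"
  then have "\<forall>i<20. u (mirror i) = 0"
    using syzygy_mirror[of a d f b e c u] F by (auto simp: free_coordinates_def)
  then show "u i = 0" using mirror_lessThan[OF \<open>i < 20\<close>] by metis
next
  have F20: "F \<subseteq> {..<20}" using F by (simp add: free_coordinates_def)
  fix j assume "j \<in> mirror ` F"
  then obtain j' where j: "j' \<in> F" "j = mirror j'" by auto
  with F obtain u where u: "syzygy (op_identity a b c d e f) u" "u j' = 1" "\<forall>i\<in>F - {j'}. u i = 0"
    by (force simp: free_coordinates_def)
  show "\<exists>u. syzygy (op_identity a d f b e c) u \<and> u j = 1 \<and> (\<forall>i\<in>mirror ` F - {j}. u i = 0)"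
    using syzygy_mirror[OF u(1)] u(2,3) j F20 mirror_lessThan(2)
    by (intro exI[of _ "\<lambda>i. u (mirror i)"]) (auto simp: subset_iff)
qed

lemma proportional_mirror:
  "op_identity a b c d e f \<propto> op_identity a' b' c' d' e' f' \<Longrightarrow>
   op_identity a d f b e c \<propto> op_identity a' d' f' b' e' c'"
  unfolding proportional_op_identity by blast

lemma rank19_identity_mirror:
  assumes "rank19_identity (op_identity a b c d e f)"
  shows "rank19_identity (op_identity a d f b e c)"
  using assms unfolding rank19_identity_iff
  by (elim disjE exE conjE) (drule proportional_mirror, blast)+

section \<open>Identities in which L(L(x)y) occurs\<close>

text \<open>
  For \<open>b = 1\<close>, the fifteen monomials used here are divisible by \<open>t w\<close>, \<open>t x\<close>, \<open>w x\<close> or \<open>v y\<close>, which occur with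
  coefficient 1 in the four forms \<open>R(t, w, z)\<close>, \<open>R(t, x, v)\<close>, \<open>R(w, x, y)\<close>, \<open>R(v, y, z)\<close>. The
  coefficients of these monomials in \<open>(E)\<close> determine all unknowns from \<open>u\<^sub>0, u\<^sub>1\<^sub>3, u\<^sub>1\<^sub>6, u\<^sub>1\<^sub>8, u\<^sub>1\<^sub>9\<close>.
\<close>

lemma syzygy_solved:
  assumes "syzygy (op_identity a 1 c d e f) u"
  shows "u 14 = - u 0" "u 5 = - (d * u 0)" "u 8 = - (e * u 0)" "u 1 = d * u 0" "u 4 = e * u 0"
    "u 15 = - (d * e * u 0)" "u 9 = - (e\<^sup>2 * u 0)"
    "u 12 = - (a * u 16)" "u 6 = - (c * u 18)" "u 10 = - (c * u 19)" "u 3 = c * u 0 - c * u 13"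
    "u 2 = - (e * u 12) - d * u 16" "u 17 = - (d * u 3) - e * u 13"
    "u 7 = - (d * u 6) - e * u 18" "u 11 = - (d * u 10) - e * u 19"
proof -
  note eqs = assms[unfolded syzygy_iff]
  have *: "u 0 + u 14 = 0" "d * u 0 + u 5 = 0" "e * u 0 + u 8 = 0" "u 1 + d * u 14 = 0" "u 4 + e * u 14 = 0"
    "d * u 4 + u 15 = 0" "e * u 4 + u 9 = 0" "u 12 + a * u 16 = 0" "u 6 + c * u 18 = 0"
    "u 10 + c * u 19 = 0" "u 3 + c * u 13 + c * u 14 = 0" "u 2 + e * u 12 + d * u 16 = 0"
    "d * u 3 + e * u 13 + u 17 = 0" "d * u 6 + u 7 + e * u 18 = 0" "d * u 10 + u 11 + e * u 19 = 0"
    using eqs by simp_all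
  show 14: "u 14 = - u 0" using *(1) by Groebner_Basis.algebra
  show "u 5 = - (d * u 0)" using *(2) by Groebner_Basis.algebra
  show "u 8 = - (e * u 0)" using *(3) by Groebner_Basis.algebra
  show "u 1 = d * u 0" using *(4) 14 by Groebner_Basis.algebra
  show 4: "u 4 = e * u 0" using *(5) 14 by Groebner_Basis.algebra
  show "u 15 = - (d * e * u 0)" using *(6) 4 by Groebner_Basis.algebra
  show "u 9 = - (e\<^sup>2 * u 0)" using *(7) 4 by Groebner_Basis.algebra
  show "u 12 = - (a * u 16)" using *(8) by Groebner_Basis.algebra
  show "u 6 = - (c * u 18)" using *(9) by Groebner_Basis.algebra
  show "u 10 = - (c * u 19)" using *(10) by Groebner_Basis.algebra
  show "u 3 = c * u 0 - c * u 13" using *(11) 14 by Groebner_Basis.algebra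
  show "u 2 = - (e * u 12) - d * u 16" using *(12) by Groebner_Basis.algebra
  show "u 17 = - (d * u 3) - e * u 13" using *(13) by Groebner_Basis.algebra
  show "u 7 = - (d * u 6) - e * u 18" using *(14) by Groebner_Basis.algebra
  show "u 11 = - (d * u 10) - e * u 19" using *(15) by Groebner_Basis.algebra
qed

lemma syzygy_zeroI:
  assumes "syzygy (op_identity a 1 c d e f) u" "u 0 = 0" "u 13 = 0" "u 16 = 0" "u 18 = 0" "u 19 = 0"
  shows "\<forall>i<20. u i = 0"
  using syzygy_solved[OF assms(1)] assms(2-) by (simp add: all_lessThan_20)

text \<open>
  The number \<open>1 - a c\<close> appears because \<open>a s\<^sup>2\<close> and \<open>c p\<^sup>2\<close> link the unknowns in pairs: the coefficients of
  \<open>t w\<^sup>2\<close> and \<open>t\<^sup>2 w\<close>, for instance, give \<open>u\<^sub>1\<^sub>6 = - c u\<^sub>1\<^sub>2\<close> and \<open>u\<^sub>1\<^sub>2 = - a u\<^sub>1\<^sub>6\<close> once \<open>u\<^sub>0 = 0\<close>.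
\<close>

lemma syzygy_outer:
  assumes "syzygy (op_identity a 1 c d e f) u" "u 0 = 0"
  shows "(1 - a * c) * u 13 = 0" "(1 - a * c) * u 16 = 0" "(1 - a * c) * u 18 = 0" "(1 - a * c) * u 19 = 0"
proof -
  note eqs = assms(1)[unfolded syzygy_iff] and solved = syzygy_solved[OF assms(1)]
  have "a * u 0 + a * u 3 + u 13 = 0" "c * u 12 + a * u 14 + u 16 = 0"
    "c * u 0 + a * u 6 + u 18 = 0" "f * u 4 + a * u 10 + u 19 = 0"
    using eqs by simp_all
  then show "(1 - a * c) * u 13 = 0" "(1 - a * c) * u 16 = 0" "(1 - a * c) * u 18 = 0" "(1 - a * c) * u 19 = 0"
    unfolding solved using assms(2) by (simp_all add: algebra_simps)
qed

lemma syzygy_zero_if_u0: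
  assumes "syzygy (op_identity a 1 c d e f) u" "u 0 = 0" "a * c \<noteq> 1"
  shows "\<forall>i<20. u i = 0"
  using syzygy_outer[OF assms(1,2)] assms by (intro syzygy_zeroI) auto

text \<open>
  The coefficients of \<open>A\<^sub>1, \<dots>, A\<^sub>4\<close> that are multiples of \<open>u\<^sub>0\<close> occur in six further equations, which force
  \<open>(d, e)\<close> to be \<open>(0, 0)\<close>, \<open>(0, -1)\<close> or \<open>(1, -1)\<close>. In each case the remaining equations restrict \<open>a\<close> and \<open>c\<close>
  through combinations in which only \<open>u\<^sub>0\<close> survives.
\<close>

lemma parameters_if_u0_nonzero:
  fixes u :: "nat \<Rightarrow> 'a::field_char_0"
  assumes syz: "syzygy (op_identity a 1 c d e f) u" and nz: "u 0 \<noteq> 0"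
  shows "(d = 0 \<and> e = 0 \<and> f = 0 \<and> (c = - (a + 1) \<or> a = 0 \<and> c = 0))
    \<or> (d = 0 \<and> e = - 1 \<and> a = 0 \<and> c = 0 \<and> f = 0)
    \<or> (d = 1 \<and> e = - 1 \<and> f = c \<and> (a = 0 \<and> c = 0 \<or> a = - 1 \<and> c = 0 \<or> a = - (1/2) \<and> c = - (1/2)))"
proof -
  note solved = syzygy_solved[OF syz]
  note eqs = syz[unfolded syzygy_iff]
  have "u 0 * (e\<^sup>2 * (1 + e)) = - (e * u 8 + e * u 9)"
    "u 0 * (d\<^sup>2 - d * e\<^sup>2) = d * u 1 + e * u 15"
    "u 0 * (f * (1 - e\<^sup>2)) = f * u 0 + f * u 9"
    "u 0 * (a * (d + e)) = a * u 1 + a * u 4"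
    "u 0 * (c * (d + e)) = - (c * u 5 + c * u 8)"
    "u 0 * (f + c * d * e) = - (f * u 14 + c * u 15)"
    unfolding solved by Groebner_Basis.algebra+
  then have inner: "e\<^sup>2 * (1 + e) = 0" "d\<^sup>2 - d * e\<^sup>2 = 0" "f * (1 - e\<^sup>2) = 0"
    "a * (d + e) = 0" "c * (d + e) = 0" "f + c * d * e = 0"
    using nz eqs by simp_all
  have "d\<^sup>2 - d * e\<^sup>2 = d * (d - e\<^sup>2)" by Groebner_Basis.algebra
  with inner(1,2) consider "e = 0" "d = 0" | "e = - 1" "d = 0" | "e = - 1" "d = 1"
    by (auto simp: add_eq_0_iff)
  then show ?thesis
  proof cases
    case 1
    with inner have f: "f = 0" by auto
    \<comment> \<open>Coefficients that involve only \<open>u\<^sub>0\<close>, \<open>u\<^sub>1\<^sub>3\<close>, \<open>u\<^sub>1\<^sub>6\<close> and \<open>u\<^sub>1\<^sub>8\<close>; all but \<open>u\<^sub>0\<close> are eliminated.\<close>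
    let ?E1 = "c * u 12 + a * u 14 + u 16" and ?E2 = "a * u 0 + a * u 3 + u 13"
      and ?E3 = "a * u 12 + a * u 13" and ?E4 = "c * u 0 + a * u 6 + u 18" and ?E5 = "c * u 3 + c * u 6"
    have E: "?E1 = 0" "?E2 = 0" "?E3 = 0" "?E4 = 0" "?E5 = 0"
      using eqs 1 by simp_all
    have "u 0 * (a\<^sup>2 * (a + c + 1)) = a * ?E2 - a\<^sup>2 * ?E1 - (1 - a * c) * ?E3"
      "u 0 * (c\<^sup>2 * (a + c + 1)) = c\<^sup>2 * ?E2 + c\<^sup>2 * ?E4 + (1 - a * c) * ?E5"
      unfolding solved by Groebner_Basis.algebra+
    then have "a + c + 1 = 0 \<or> a = 0 \<and> c = 0"
      using nz unfolding E by auto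
    moreover have "c = - (a + 1)" if "a + c + 1 = 0"
      using that by Groebner_Basis.algebra
    ultimately show ?thesis
      using 1 f by blast
  next
    case 2
    with inner show ?thesis by simp
  next
    case 3
    with inner have f: "f = c" by (simp add: algebra_simps)
    \<comment> \<open>The first, second and fifth of these involve only \<open>u\<^sub>0\<close> and \<open>u\<^sub>1\<^sub>8\<close>, the others only \<open>u\<^sub>0\<close> and
      \<open>u\<^sub>1\<^sub>6\<close>.\<close>
    let ?E1 = "c * u 0 + a * u 6 + u 18" and ?E2 = "d * u 7 + f * u 18"
      and ?E3 = "c * u 2 + a * u 8 + e * u 16" and ?E4 = "e * u 2 + f * u 16"
      and ?E5 = "c * u 4 + e * u 6 + c * u 7"
    have E: "?E1 = 0" "?E2 = 0" "?E3 = 0" "?E4 = 0" "?E5 = 0"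
      using eqs by simp_all
    have "u 0 * (c * (2 * c + 1)) = (2 * c + 1) * ?E1 - (1 - a * c) * ?E2"
      "u 0 * (a * (a + c + 1)) = (a + c + 1) * ?E3 + (c * (a + 1) + 1) * ?E4"
      unfolding solved 3 f by Groebner_Basis.algebra+
    then have ac: "c = 0 \<or> 2 * c + 1 = 0" "a = 0 \<or> a + c + 1 = 0"
      using nz unfolding E by auto
    \<comment> \<open>Needed to exclude \<open>a = 0\<close>, \<open>c = - 1/2\<close>.\<close>
    have a0: "c = 0" if "a = 0" "2 * c + 1 = 0"
    proof -
      have "u 0 * c ^ 3 = c * (c + 2) * ?E1 - ?E5 - u 0 * c * (2 * c + 1)"
        unfolding solved 3 f that(1) by Groebner_Basis.algebra
      then show ?thesis using nz unfolding E that(2) by simp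
    qed
    have half: "x = - (1/2)" if "2 * x + 1 = 0" for x :: 'a
      using that by (simp add: field_simps add_eq_0_iff)
    have "a = - 1" if "c = 0" "a + c + 1 = 0"
      using that by (simp add: add_eq_0_iff2)
    moreover have "a = - (1/2)" if "2 * c + 1 = 0" "a + c + 1 = 0"
    proof (rule half)
      show "2 * a + 1 = 0" using that by Groebner_Basis.algebra
    qed
    ultimately show ?thesis
      using ac a0 half 3 f by auto
  qed
qed

text \<open>
  If \<open>u\<^sub>0 = 0\<close> then \<open>a c = 1\<close> and \<open>u\<^sub>1\<^sub>6\<close> determines everything. Its equations give \<open>c\<^sup>3 = 1\<close>; this is the
  telescoping relation \<open>(w - t) R(t, w) + (t - x) R(t, x) + (x - w) R(w, x) = 0\<close> between differences of
  cubes for \<open>R(s, p) = s\<^sup>2 + s p + p\<^sup>2\<close>. For a primitive cube root of unity \<open>c\<close>, the form is divisible by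
  \<open>s - p\<close>, that is, its coefficients add up to zero.
\<close>

lemma parameters_if_u0_zero:
  fixes u :: "nat \<Rightarrow> 'a::field_char_0"
  assumes syz: "syzygy (op_identity a 1 c d e f) u" and u0: "u 0 = 0" and nz: "\<not> (\<forall>i<20. u i = 0)"
  shows "d = 0 \<and> e = 0 \<and> f = 0 \<and> (c = - (a + 1) \<or> a = 1 \<and> c = 1)"
proof -
  note solved = syzygy_solved[OF syz]
  note eqs = syz[unfolded syzygy_iff]
  have ac: "a * c = 1"
    using syzygy_zero_if_u0[OF syz u0] nz by blast
  have "a * u 12 + a * u 13 = 0" "c * u 16 + a * u 18 = 0" "f * u 17 + a * u 19 = 0"
    using eqs by blast+
  have 13: "u 13 = a * u 16"
  proof -
    have "u 13 - a * u 16 = c * (a * u 12 + a * u 13)"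
      unfolding solved using ac by Groebner_Basis.algebra
    then show ?thesis using eqs by simp
  qed
  have 18: "u 18 = - (c\<^sup>2 * u 16)"
  proof -
    have "u 18 + c\<^sup>2 * u 16 = c * (c * u 16 + a * u 18)"
      using ac by Groebner_Basis.algebra
    then show ?thesis using eqs by (simp add: add_eq_0_iff2)
  qed
  have 19: "u 19 = - (c * f * u 17)"
  proof -
    have "u 19 + c * f * u 17 = c * (f * u 17 + a * u 19)"
      using ac by Groebner_Basis.algebra
    then show ?thesis using eqs by (simp add: add_eq_0_iff2)
  qed
  have s: "u 16 \<noteq> 0"
  proof
    assume "u 16 = 0"
    then have "\<forall>i<20. u i = 0"
      using u0 by (intro syzygy_zeroI[OF syz]) (simp_all add: 13 18 19 solved)
    with nz show False ..
  qed
  have "u 16 * (c * (c ^ 3 - 1)) = c * u 3 + c * u 6"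
    "u 16 * (2 * e - c * d) = c * u 2 + a * u 8 + e * u 16"
    "u 16 * (e - 2 * c * d) = c\<^sup>2 * (a * u 2 + a * u 5 + d * u 12)"
    using ac unfolding solved 13 18 u0 by Groebner_Basis.algebra+
  then have *: "c * (c ^ 3 - 1) = 0" "2 * e = c * d" "e = 2 * c * d"
    using s eqs by simp_all
  have "3 * e = 0" using *(2,3) by Groebner_Basis.algebra
  then have e: "e = 0" by simp
  then have d: "d = 0" using *(2) ac by auto
  have f: "f = 0" using eqs s e by auto
  have "(c - 1) * (c\<^sup>2 + c + 1) = 0" using * ac by Groebner_Basis.algebra
  moreover have "c = - (a + 1)" if "c\<^sup>2 + c + 1 = 0" using that ac by Groebner_Basis.algebra
  ultimately show ?thesis
    using d e f ac by auto
qed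

lemma rank19_identity_if_syzygy_b:
  fixes u :: "nat \<Rightarrow> 'a::field_char_0"
  assumes "syzygy (op_identity a b c d e f) u" "\<not> (\<forall>i<20. u i = 0)" "b \<noteq> 0"
  shows "rank19_identity (op_identity a b c d e f)"
proof -
  define a' c' d' e' f' where "a' = a / b" "c' = c / b" "d' = d / b" "e' = e / b" "f' = f / b"
  then have scale: "op_identity a b c d e f \<propto> op_identity a' 1 c' d' e' f'"
    unfolding proportional_op_identity using assms(3) by (intro exI[of _ b]) simp
  then have syz: "syzygy (op_identity a' 1 c' d' e' f') u"
    using assms(1) syzygy_proportional by metis
  have "(d' = 0 \<and> e' = 0 \<and> f' = 0 \<and> (c' = - (a' + 1) \<or> a' = 0 \<and> c' = 0 \<or> a' = 1 \<and> c' = 1))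
    \<or> (d' = 0 \<and> e' = - 1 \<and> a' = 0 \<and> c' = 0 \<and> f' = 0)
    \<or> (d' = 1 \<and> e' = - 1 \<and> f' = c' \<and> (a' = 0 \<and> c' = 0 \<or> a' = - 1 \<and> c' = 0 \<or> a' = - (1/2) \<and> c' = - (1/2)))"
    using parameters_if_u0_nonzero[OF syz] parameters_if_u0_zero[OF syz _ assms(2)] by blast
  then consider "d' = 0" "e' = 0" "f' = 0" "c' = - (a' + 1)" "a' = 0"
    | "d' = 0" "e' = 0" "f' = 0" "c' = - (a' + 1)" "a' \<noteq> 0"
    | "d' = 0" "e' = 0" "f' = 0" "a' = 0" "c' = 0"
    | "d' = 0" "e' = 0" "f' = 0" "a' = 1" "c' = 1"
    | "d' = 0" "e' = - 1" "a' = 0" "c' = 0" "f' = 0"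
    | "d' = 1" "e' = - 1" "a' = 0" "c' = 0" "f' = 0"
    | "d' = 1" "e' = - 1" "a' = - 1" "c' = 0" "f' = 0"
    | "d' = 1" "e' = - 1" "a' = - (1/2)" "c' = - (1/2)" "f' = - (1/2)"
    by metis
  then have "rank19_identity (op_identity a' 1 c' d' e' f')"
  proof cases
    case 2
    moreover have "- (a' + 1) = a' * (- (1 / a' + 1))"
      using \<open>a' \<noteq> 0\<close> by (simp add: algebra_simps)
    ultimately have "op_identity a' 1 c' d' e' f' \<propto> op_identity 1 (1 / a') (- (1 / a' + 1)) 0 0 0"
      unfolding proportional_op_identity by (intro exI[of _ a']) auto
    then show ?thesis
      using \<open>a' \<noteq> 0\<close> unfolding rank19_identity_iff by (metis divide_eq_0_iff one_neq_zero)
  next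
    case 7
    then have "op_identity a' 1 c' d' e' f' \<propto> op_identity 1 (- 1) 0 (- 1) 1 0"
      unfolding proportional_op_identity by (intro exI[of _ "- 1"]) simp
    then show ?thesis unfolding rank19_identity_iff by blast
  next
    case 8
    then have "op_identity a' 1 c' d' e' f' \<propto> op_identity 1 (- 2) 1 (- 2) 2 1"
      unfolding proportional_op_identity by (intro exI[of _ "- (1/2)"]) simp
    then show ?thesis unfolding rank19_identity_iff by blast
  qed (simp_all add: rank19_identity_iff proportional_refl)
  then show ?thesis
    using scale proportional_trans unfolding rank19_identity_iff by blast
qed

section \<open>Identities in which neither L(L(x)y) nor L(xL(y)) occurs\<close>

lemma rank19_identity_if_syzygy_e:
  fixes u :: "nat \<Rightarrow> 'a::field_char_0"
  assumes syz: "syzygy (op_identity a 0 c 0 e f) u" and nz: "\<not> (\<forall>i<20. u i = 0)" and e: "e \<noteq> 0"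
  shows "rank19_identity (op_identity a 0 c 0 e f)"
proof -
  note eqs = syz[unfolded syzygy_iff]
  have inner: "u 0 = 0" "u 1 = 0" "u 4 = 0" "u 5 = 0" "u 14 = 0" "u 15 = 0" "u 12 = 0" "u 13 = 0"
    "u 18 = 0" "u 19 = 0"
    using eqs e by simp_all
  have 9: "u 9 = - u 8" using eqs e by (simp add: add_eq_0_iff distrib_left[symmetric])
  \<comment> \<open>The unknowns other than \<open>u\<^sub>8\<close>, \<open>u\<^sub>9\<close> that are left occur in pairs, each subject to a system with
    determinant \<open>e\<^sup>2 - p q\<close>; the third equation is what excludes solutions if that vanishes.\<close>
  have zero: "x = 0 \<and> y = 0" if "e * x + p * y = 0" "q * x + e * y = 0" "q * y = 0" for p q x y
  proof -
    have "e * (q * x) = q * (e * x + p * y) - p * (q * y)"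
      by (simp add: algebra_simps)
    with e have "q * x = 0" unfolding that(1,3) by simp
    with that e show ?thesis by simp
  qed
  have 8: "u 8 \<noteq> 0"
  proof
    assume "u 8 = 0"
    have "u 2 = 0 \<and> u 16 = 0"
      by (rule zero[of _ f _ c]) (use eqs inner \<open>u 8 = 0\<close> in simp_all)
    moreover have "u 3 = 0 \<and> u 17 = 0"
      by (rule zero[of _ c _ f]) (use eqs inner 9 \<open>u 8 = 0\<close> in simp_all)
    moreover from calculation have "u 7 = 0 \<and> u 6 = 0"
      by (intro zero[of _ f _ c]) (use eqs inner 9 \<open>u 8 = 0\<close> in \<open>simp_all add: add.commute\<close>)
    moreover from calculation have "u 10 = 0 \<and> u 11 = 0"
      by (intro zero[of _ c _ f]) (use eqs inner \<open>u 8 = 0\<close> in simp_all)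
    ultimately show False
      using nz inner 9 \<open>u 8 = 0\<close> by (simp add: all_lessThan_20)
  qed
  have "c * u 5 + c * u 8 = 0" "f * u 0 + f * u 9 = 0"
    using eqs by blast+
  with 8 9 inner have cf: "c = 0" "f = 0" by simp_all
  have zeros: "a * u 8 + e * u 16 = 0" "a * u 16 = 0"
    using eqs cf by simp_all
  have "a * a * u 8 = a * (a * u 8 + e * u 16) - e * (a * u 16)"
    by (simp add: algebra_simps)
  with 8 have "a = 0" unfolding zeros by simp
  with cf have "a = 0 \<and> c = 0 \<and> f = 0" by blast
  then have "op_identity a 0 c 0 e f \<propto> op_identity 0 0 0 0 1 0"
    unfolding proportional_op_identity using e by (intro exI[of _ e]) simp
  then show ?thesis unfolding rank19_identity_iff by blast
qed

text \<open>
  The parameters for which \<open>R = a s\<^sup>2 + c p\<^sup>2 + f q\<^sup>2\<close> admits constants \<open>v\<^sub>i\<close>, not all zero, with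
  \<open>v\<^sub>1 R(t, w, z) + v\<^sub>2 R(t, x, v) + v\<^sub>3 R(w, x, y) + v\<^sub>4 R(v, y, z) = 0\<close>: the six hypotheses are the coefficients
  of \<open>t\<^sup>2, w\<^sup>2, x\<^sup>2, z\<^sup>2, v\<^sup>2, y\<^sup>2\<close>.
\<close>

lemma parameters_of_constant_relation:
  fixes a c f :: "'a::field"
  assumes "a * v1 + a * v2 = 0" "c * v1 + a * v3 = 0" "c * v2 + c * v3 = 0" "f * v1 + f * v4 = 0"
    "f * v2 + a * v4 = 0" "f * v3 + c * v4 = 0"
    and "\<not> (v1 = 0 \<and> v2 = 0 \<and> v3 = 0 \<and> v4 = 0)" and "\<not> (a = 0 \<and> c = 0 \<and> f = 0)"
  shows "a \<noteq> 0 \<and> (c = 0 \<or> c = - a) \<and> (f = 0 \<or> f = - a) \<or> a = 0 \<and> c = 0 \<or> a = 0 \<and> f = 0"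
proof (cases "a = 0")
  case True
  have "c = 0 \<or> f = 0"
    using assms True by auto
  then show ?thesis using True by auto
next
  case False
  have v: "v2 = - v1"
    using assms(1) False by (simp add: distrib_left[symmetric] add_eq_0_iff)
  have v1: "v1 \<noteq> 0"
    using assms(2,5,7) False v by auto
  have "v1 * (c * (c + a)) = c * (c * v1 + a * v3) - a * (c * v2 + c * v3)"
    "v1 * (f * (f + a)) = a * (f * v1 + f * v4) - f * (f * v2 + a * v4)"
    unfolding v by Groebner_Basis.algebra+
  then have "c * (c + a) = 0" "f * (f + a) = 0"
    using assms v1 by simp_all
  then show ?thesis
    using False by (auto simp: add_eq_0_iff2)
qed

text \<open>
  Without mixed terms in \<open>R\<close>, the equations \<open>(E)\<close> decouple into one system as in the previous lemma for
  each of the common variables \<open>x, y, z, t\<close> of the linear forms.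
\<close>

lemma rank16_identity_if_syzygy:
  fixes u :: "nat \<Rightarrow> 'a::field_char_0"
  assumes syz: "syzygy (op_identity a 0 c 0 0 f) u" and nz: "\<not> (\<forall>i<20. u i = 0)"
    and "\<not> (a = 0 \<and> c = 0 \<and> f = 0)"
  shows "rank16_identity (op_identity a 0 c 0 0 f)"
proof -
  note eqs = syz[unfolded syzygy_iff]
  have "u 16 = 0" "u 17 = 0" "u 18 = 0" "u 19 = 0"
    using eqs assms(3) by auto
  with nz consider "\<not> (u 0 = 0 \<and> u 3 = 0 \<and> u 6 = 0 \<and> u 9 = 0)"
    | "\<not> (u 1 = 0 \<and> u 4 = 0 \<and> u 7 = 0 \<and> u 10 = 0)"
    | "\<not> (u 2 = 0 \<and> u 5 = 0 \<and> u 8 = 0 \<and> u 11 = 0)"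
    | "\<not> (u 12 = 0 \<and> u 13 = 0 \<and> u 14 = 0 \<and> u 15 = 0)"
    unfolding all_lessThan_20 by blast
  then have "a \<noteq> 0 \<and> (c = 0 \<or> c = - a) \<and> (f = 0 \<or> f = - a) \<or> a = 0 \<and> c = 0 \<or> a = 0 \<and> f = 0"
    by cases (erule parameters_of_constant_relation[OF _ _ _ _ _ _ _ assms(3), rotated -1]; use eqs in simp)+
  then consider "a \<noteq> 0" "c = 0" "f = 0" | "a \<noteq> 0" "c = 0" "f = - a" | "a \<noteq> 0" "c = - a" "f = 0"
    | "a \<noteq> 0" "c = - a" "f = - a" | "f \<noteq> 0" "a = 0" "c = 0" | "c \<noteq> 0" "a = 0" "f = 0"
    using assms(3) by blast
  then show ?thesis
    unfolding rank16_identity_iff proportional_op_identity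
    by cases simp_all
qed

lemma free_coordinates_empty:
  fixes a :: "'a::field_char_0"
  assumes "\<not> (a = 0 \<and> b = 0 \<and> c = 0 \<and> d = 0 \<and> e = 0 \<and> f = 0)"
    and "\<not> rank16_identity (op_identity a b c d e f)" "\<not> rank19_identity (op_identity a b c d e f)"
  shows "free_coordinates (op_identity a b c d e f) {}"
proof -
  have "\<forall>i<20. u i = 0" if syz: "syzygy (op_identity a b c d e f) u" for u
  proof (rule ccontr)
    assume nz: "\<not> (\<forall>i<20. u i = 0)"
    have b: "b = 0"
      using rank19_identity_if_syzygy_b[OF syz nz] assms(3) by blast
    have d: "d = 0"
    proof (rule ccontr)
      assume "d \<noteq> 0"
      moreover have "\<not> (\<forall>i<20. u (mirror i) = 0)"
        using nz mirror_lessThan by metis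
      ultimately have "rank19_identity (op_identity a d f b e c)"
        using rank19_identity_if_syzygy_b[OF syzygy_mirror[OF syz]] by blast
      then show False
        using rank19_identity_mirror assms(3) by blast
    qed
    have e: "e = 0"
      using rank19_identity_if_syzygy_e[of a c e f u] syz nz assms(3) b d by blast
    show False
      using rank16_identity_if_syzygy[of a c f u] syz nz assms b d e by blast
  qed
  then show ?thesis by (simp add: free_coordinates_def)
qed

section \<open>The kernels for the listed identities\<close>

text \<open>
  For each of the multipliers \<open>x, y, z, t\<close> there is the relation with constants
  \<open>(1, -1, -c, f)\<close>. For \<open>p\<^sup>2\<close> the constants are \<open>(0, 1, -1, 0)\<close>.
\<close>

lemma free_coordinates_squares:
  fixes c f :: "'a::field"
  assumes "c = 0 \<or> c = - 1" "f = 0 \<or> f = - 1"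
  shows "free_coordinates (op_identity 1 0 c 0 0 f) {0, 1, 2, 12}"
proof -
  have "\<forall>i<20. u i = 0" if "syzygy (op_identity 1 0 c 0 0 f) u" "\<forall>j\<in>{0, 1, 2, 12}. u j = 0" for u
  proof -
    have "u 0 + u 3 = 0" "u 1 + u 4 = 0" "u 2 + u 5 = 0" "c * u 0 + u 6 = 0" "c * u 1 + u 7 = 0"
      "c * u 2 + u 8 = 0" "f * u 3 + u 9 = 0" "f * u 4 + u 10 = 0" "f * u 5 + u 11 = 0"
      "u 12 + u 13 = 0" "c * u 12 + u 14 = 0" "f * u 13 + u 15 = 0" "u 16 = 0" "u 17 = 0"
      using that(1)[unfolded syzygy_iff] by simp_all
    moreover from this have "u 18 = 0" "u 19 = 0"
      using that(1)[unfolded syzygy_iff] by auto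
    ultimately show ?thesis
      using that(2) by (simp add: all_lessThan_20)
  qed
  moreover have "\<forall>j\<in>{0, 1, 2, 12}.
      \<exists>u. syzygy (op_identity 1 0 c 0 0 f) u \<and> u j = 1 \<and> (\<forall>i\<in>{0, 1, 2, 12} - {j}. u i = 0)"
    unfolding ball_simps
  proof (intro conjI)
    have "syzygy (op_identity 1 0 c 0 0 f)
        (\<lambda>i. [1, 0, 0, - 1, 0, 0, - c, 0, 0, f, 0, 0, 0, 0, 0, 0, 0, 0, 0, 0] ! i)"
      unfolding syzygy_iff using assms by auto
    then show "\<exists>u. syzygy (op_identity 1 0 c 0 0 f) u \<and> u 0 = 1 \<and> (\<forall>i\<in>{0, 1, 2, 12} - {0}. u i = 0)"
      by - (rule exI, rule conjI, assumption, auto)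
    have "syzygy (op_identity 1 0 c 0 0 f)
        (\<lambda>i. [0, 1, 0, 0, - 1, 0, 0, - c, 0, 0, f, 0, 0, 0, 0, 0, 0, 0, 0, 0] ! i)"
      unfolding syzygy_iff using assms by auto
    then show "\<exists>u. syzygy (op_identity 1 0 c 0 0 f) u \<and> u 1 = 1 \<and> (\<forall>i\<in>{0, 1, 2, 12} - {1}. u i = 0)"
      by - (rule exI, rule conjI, assumption, auto)
    have "syzygy (op_identity 1 0 c 0 0 f)
        (\<lambda>i. [0, 0, 1, 0, 0, - 1, 0, 0, - c, 0, 0, f, 0, 0, 0, 0, 0, 0, 0, 0] ! i)"
      unfolding syzygy_iff using assms by auto
    then show "\<exists>u. syzygy (op_identity 1 0 c 0 0 f) u \<and> u 2 = 1 \<and> (\<forall>i\<in>{0, 1, 2, 12} - {2}. u i = 0)"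
      by - (rule exI, rule conjI, assumption, auto)
    have "syzygy (op_identity 1 0 c 0 0 f)
        (\<lambda>i. [0, 0, 0, 0, 0, 0, 0, 0, 0, 0, 0, 0, 1, - 1, - c, f, 0, 0, 0, 0] ! i)"
      unfolding syzygy_iff using assms by auto
    then show "\<exists>u. syzygy (op_identity 1 0 c 0 0 f) u \<and> u 12 = 1 \<and> (\<forall>i\<in>{0, 1, 2, 12} - {12}. u i = 0)"
      by - (rule exI, rule conjI, assumption, auto)
  qed simp
  ultimately show ?thesis
    by (simp add: free_coordinates_def)
qed

lemma free_coordinates_p_square:
  shows "free_coordinates (op_identity (0::'a::field) 0 1 0 0 0) {3, 4, 5, 13}"
proof -
  have "\<forall>i<20. u i = 0" if "syzygy (op_identity (0::'a) 0 1 0 0 0) u"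
    "\<forall>j\<in>{3, 4, 5, 13}. u j = 0" for u
    using that unfolding syzygy_iff by (auto simp: all_lessThan_20)
  moreover have "\<forall>j\<in>{3, 4, 5, 13}.
      \<exists>u. syzygy (op_identity (0::'a) 0 1 0 0 0) u \<and> u j = 1 \<and> (\<forall>i\<in>{3, 4, 5, 13} - {j}. u i = 0)"
    unfolding ball_simps
  proof (intro conjI)
    have "syzygy (op_identity (0::'a) 0 1 0 0 0)
        (\<lambda>i. [0, 0, 0, 1, 0, 0, - 1, 0, 0, 0, 0, 0, 0, 0, 0, 0, 0, 0, 0, 0] ! i)"
      unfolding syzygy_iff by simp
    then show "\<exists>u. syzygy (op_identity (0::'a) 0 1 0 0 0) u \<and> u 3 = 1 \<and> (\<forall>i\<in>{3, 4, 5, 13} - {3}. u i = 0)"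
      by - (rule exI, rule conjI, assumption, auto)
    have "syzygy (op_identity (0::'a) 0 1 0 0 0)
        (\<lambda>i. [0, 0, 0, 0, 1, 0, 0, - 1, 0, 0, 0, 0, 0, 0, 0, 0, 0, 0, 0, 0] ! i)"
      unfolding syzygy_iff by simp
    then show "\<exists>u. syzygy (op_identity (0::'a) 0 1 0 0 0) u \<and> u 4 = 1 \<and> (\<forall>i\<in>{3, 4, 5, 13} - {4}. u i = 0)"
      by - (rule exI, rule conjI, assumption, auto)
    have "syzygy (op_identity (0::'a) 0 1 0 0 0)
        (\<lambda>i. [0, 0, 0, 0, 0, 1, 0, 0, - 1, 0, 0, 0, 0, 0, 0, 0, 0, 0, 0, 0] ! i)"
      unfolding syzygy_iff by simp
    then show "\<exists>u. syzygy (op_identity (0::'a) 0 1 0 0 0) u \<and> u 5 = 1 \<and> (\<forall>i\<in>{3, 4, 5, 13} - {5}. u i = 0)"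
      by - (rule exI, rule conjI, assumption, auto)
    have "syzygy (op_identity (0::'a) 0 1 0 0 0)
        (\<lambda>i. [0, 0, 0, 0, 0, 0, 0, 0, 0, 0, 0, 0, 0, 1, - 1, 0, 0, 0, 0, 0] ! i)"
      unfolding syzygy_iff by simp
    then show "\<exists>u. syzygy (op_identity (0::'a) 0 1 0 0 0) u \<and> u 13 = 1 \<and> (\<forall>i\<in>{3, 4, 5, 13} - {13}. u i = 0)"
      by - (rule exI, rule conjI, assumption, auto)
  qed simp
  ultimately show ?thesis
    by (simp add: free_coordinates_def)
qed

lemma rank16_identity_nullity:
  assumes "rank16_identity R"
  shows "\<exists>F. free_coordinates R F \<and> card F = 4"
proof -
  have *: "\<exists>F. free_coordinates R F \<and> card F = 4" if "R \<propto> S" "free_coordinates S F" "card F = 4" for S F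
    using that free_coordinates_proportional by blast
  have "free_coordinates (op_identity (0::'a) 0 0 0 0 1) (mirror ` {3, 4, 5, 13})"
    by (rule free_coordinates_mirror[OF free_coordinates_p_square])
  then have right: "free_coordinates (op_identity (0::'a) 0 0 0 0 1) {2, 1, 0, 12}"
    by (simp add: mirror_def)
  from assms consider c f where "c = 0 \<or> c = - 1" "f = 0 \<or> f = - 1" "R \<propto> op_identity 1 0 c 0 0 f"
    | "R \<propto> op_identity 0 0 1 0 0 0" | "R \<propto> op_identity 0 0 0 0 0 1"
    unfolding rank16_identity_iff by blast
  then show ?thesis
  proof cases
    case 1
    then show ?thesis
      using * free_coordinates_squares[of c f] by fastforce
  next
    case 2
    then show ?thesis
      using * free_coordinates_p_square by fastforce
  next
    case 3
    then show ?thesis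
      using * right by fastforce
  qed
qed

lemma free_coordinates_u0:
  assumes "syzygy (op_identity a 1 c d e f) u" "u 0 = 1" "a * c \<noteq> 1"
  shows "free_coordinates (op_identity a 1 c d e f) {0}"
  by (rule free_coordinate_singletonI[OF _ assms(1,2)])
    (simp, erule (1) syzygy_zero_if_u0[OF _ _ assms(3)])

text \<open>
  For the one-parameter family the coordinate \<open>u\<^sub>0\<close> cannot be used, since it vanishes on the kernel when
  the parameter is a primitive cube root of unity; \<open>u\<^sub>1\<^sub>3\<close> determines the kernel throughout.
\<close>

lemma free_coordinates_u13:
  assumes "syzygy (op_identity a 1 c 0 0 0) u" "u 13 = 1" "a \<noteq> 0" "c \<noteq> - 1"
  shows "free_coordinates (op_identity a 1 c 0 0 0) {13}"
  using _ assms(1,2)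
proof (rule free_coordinate_singletonI)
  fix u assume syz: "syzygy (op_identity a 1 c 0 0 0) u" and "u 13 = 0"
  note solved = syzygy_solved[OF syz]
  have *: "a * u 0 + a * u 3 + u 13 = 0" "a * u 12 + a * u 13 = 0" "c * u 16 + a * u 18 = 0" "a * u 19 = 0"
    using syz[unfolded syzygy_iff] by simp_all
  have "a * (1 + c) * u 0 = a * u 0 + a * u 3 + u 13"
    using \<open>u 13 = 0\<close> unfolding solved by (simp add: algebra_simps)
  then have "u 0 = 0"
    using * assms by (simp add: add_eq_0_iff)
  then show "\<forall>i<20. u i = 0"
    using * assms \<open>u 13 = 0\<close> by (intro syzygy_zeroI[OF syz]) (auto simp: solved)
qed simp

text \<open>
  Up to reversal and rescaling, the listed forms are \<open>s\<^sup>2 + s p + p\<^sup>2\<close>, \<open>(s - p) (s + (\<beta> + 1) p)\<close>,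
  \<open>(s - p - q)\<^sup>2\<close>, \<open>(s - p) (s - q)\<close>, \<open>(s - p) p\<close>, \<open>(s - q) p\<close>, \<open>s p\<close>, \<open>s p + s q - p q\<close> and \<open>p q\<close>. Each of them
  has an explicit relation, unique because one of its coordinates determines it.
\<close>

lemma rank19_identity_nullity:
  fixes R :: "opword \<Rightarrow>\<^sub>0 'a::field_char_0"
  assumes "rank19_identity R"
  shows "\<exists>F. free_coordinates R F \<and> card F = 1"
proof -
  define N where "N S \<longleftrightarrow> (\<exists>j. free_coordinates S {j})" for S :: "opword \<Rightarrow>\<^sub>0 'a"
  have scaled: "N S" if "S \<propto> T" "N T" for S T
    using that free_coordinates_proportional by (auto simp: N_def)
  have mirror: "N (op_identity a d f b e c)" if "N (op_identity a b c d e f)" for a b c d e f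
    using that free_coordinates_mirror[of a b c d e f] unfolding N_def by fastforce
  have u0: "N (op_identity a 1 c d e f)"
    if "syzygy (op_identity a 1 c d e f) u" "u 0 = 1" "a * c \<noteq> 1" for a c d e f u
    using free_coordinates_u0[OF that] by (auto simp: N_def)
  have all_ones: "N (op_identity 1 1 1 0 0 0)"
    unfolding N_def
    by (rule exI, rule free_coordinates_u13[where
          u = "\<lambda>i. [0, 0, 0, -1, 0, 0, 1, 0, 0, 0, 0, 0, -1, 1, 0, 0, 1, 0, -1, 0] ! i"])
      (simp_all add: syzygy_iff)
  have family: "N (op_identity 1 \<beta> (- (\<beta> + 1)) 0 0 0)" if "\<beta> \<noteq> 0" for \<beta>
  proof (rule scaled)
    show "op_identity 1 \<beta> (- (\<beta> + 1)) 0 0 0 \<propto> op_identity (1 / \<beta>) 1 (- (\<beta> + 1) / \<beta>) 0 0 0"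
      unfolding proportional_op_identity using that by (intro exI[of _ \<beta>]) simp
    show "N (op_identity (1 / \<beta>) 1 (- (\<beta> + 1) / \<beta>) 0 0 0)"
      \<comment> \<open>The solution with \<open>u\<^sub>1\<^sub>3 = 1\<close>; it has \<open>u\<^sub>0 = 0\<close> if \<open>\<beta>\<close> is a primitive cube root of unity.\<close>
      unfolding N_def
      by (rule exI, rule free_coordinates_u13[where
          u = "\<lambda>i. [1 + \<beta> + \<beta>\<^sup>2, 0, 0, - ((1 + \<beta>)\<^sup>2), 0, 0, (1 + \<beta>)\<^sup>2, 0, 0, 0, 0, 0, - 1, 1,
            - (1 + \<beta> + \<beta>\<^sup>2), 0, \<beta>, 0, \<beta> * (1 + \<beta>), 0] ! i"])
        (use that in \<open>auto simp: syzygy_iff field_simps power2_eq_square\<close>)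
  qed
  have derivation_square: "N (op_identity 1 (- 2) 1 (- 2) 2 1)"
  proof (rule scaled)
    show "op_identity 1 (- 2) 1 (- 2) 2 1 \<propto> op_identity (- (1/2)) 1 (- (1/2)) 1 (- 1) (- (1/2) :: 'a)"
      unfolding proportional_op_identity by (intro exI[of _ "- 2"]) simp
    show "N (op_identity (- (1/2)) 1 (- (1/2)) 1 (- 1) (- (1/2)))"
      by (rule u0[where u = "\<lambda>i. [1, 1, 1/3, -(1/3), -1, -1, 1/3, 1/3, 1, -1, -(1/3), -(1/3), -(1/3), 1/3,
            -1, 1, -(2/3), 2/3, 2/3, -(2/3)] ! i"])
        (simp_all add: syzygy_iff)
  qed
  have nijenhuis: "N (op_identity 1 (- 1) 0 (- 1) 1 0)"
  proof (rule scaled)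
    show "op_identity 1 (- 1) 0 (- 1) 1 0 \<propto> op_identity (- 1) 1 0 1 (- 1) (0 :: 'a)"
      unfolding proportional_op_identity by (intro exI[of _ "- 1"]) simp
    show "N (op_identity (- 1) 1 0 1 (- 1) 0)"
      by (rule u0[where u = "\<lambda>i. [1, 1, 0, 0, -1, -1, 0, 0, 1, -1, 0, 0, -1, 1, -1, 1, -1, 1, 0, 0] ! i"])
        (simp_all add: syzygy_iff)
  qed
  have diff_times_left: "N (op_identity 0 1 (- 1) 0 0 0)"
    by (rule u0[where u = "\<lambda>i. [1, 0, 0, -1, 0, 0, 1, 0, 0, 0, 0, 0, 0, 0, -1, 0, 0, 0, 1, 0] ! i"])
      (simp_all add: syzygy_iff)
  have averaging: "N (op_identity 0 1 0 0 (- 1) 0)"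
    by (rule u0[where u = "\<lambda>i. [1, 0, 0, 0, -1, 0, 0, 0, 1, -1, 0, 0, 0, 0, -1, 0, 0, 0, 0, 0] ! i"])
      (simp_all add: syzygy_iff)
  have inner_left: "N (op_identity 0 1 0 0 0 0)"
    by (rule u0[where u = "\<lambda>i. [1, 0, 0, 0, 0, 0, 0, 0, 0, 0, 0, 0, 0, 0, -1, 0, 0, 0, 0, 0] ! i"])
      (simp_all add: syzygy_iff)
  have rota_baxter: "N (op_identity 0 1 0 1 (- 1) 0)"
    by (rule u0[where u = "\<lambda>i. [1, 1, 0, 0, -1, -1, 0, 0, 1, -1, 0, 0, 0, 0, -1, 1, 0, 0, 0, 0] ! i"])
      (simp_all add: syzygy_iff)
  have product: "N (op_identity 0 0 0 0 1 0)"
    unfolding N_def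
    by (rule exI, rule free_coordinate_singletonI[where j = 8 and
          u = "\<lambda>i. [0, 0, 0, 0, 0, 0, 0, 0, 1, -1, 0, 0, 0, 0, 0, 0, 0, 0, 0, 0] ! i"])
      (simp_all add: syzygy_iff all_lessThan_20)
  have "N R"
    using assms unfolding rank19_identity_iff
    by (elim disjE exE conjE)
      (erule scaled, (rule all_ones family derivation_square nijenhuis diff_times_left averaging
          inner_left rota_baxter product all_ones[THEN mirror] family[THEN mirror]
          diff_times_left[THEN mirror] averaging[THEN mirror] inner_left[THEN mirror]; assumption?))+
  then show ?thesis by (auto simp: N_def)
qed

section \<open>The ranks\<close>

theorem theorem6p12:
  fixes a b c d e f :: "'a::field_char_0"
    and R :: "opword \<Rightarrow>\<^sub>0 'a"
    and bs :: "opword list"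
  assumes nonzero: "\<not> (a = 0 \<and> b = 0 \<and> c = 0 \<and> d = 0 \<and> e = 0 \<and> f = 0)"
    and R: "R = a \<cdot> bas (L2 (X \<diamondop> Y)) + b \<cdot> bas (L (L X \<diamondop> Y)) + c \<cdot> bas (L2 X \<diamondop> Y)
              + d \<cdot> bas (L (X \<diamondop> L Y)) + e \<cdot> bas (L X \<diamondop> L Y) + f \<cdot> bas (X \<diamondop> L2 Y)"
    and basis: "distinct bs" "set bs = opmonomials 3 3"
  shows "(mat_rank (transpose_mat (consequence_matrix bs R)) = 16 \<longleftrightarrow> rank16_identity R)
    \<and> (mat_rank (transpose_mat (consequence_matrix bs R)) = 19 \<longleftrightarrow> rank19_identity R)
    \<and> (\<not> rank16_identity R \<and> \<not> rank19_identity R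
         \<longrightarrow> mat_rank (transpose_mat (consequence_matrix bs R)) = 20)"
proof -
  have R': "R = op_identity a b c d e f"
    by (simp add: R op_identity_def)
  let ?r = "mat_rank (transpose_mat (consequence_matrix bs R))"
  have rank: "?r = 20 - card F" if "free_coordinates R F" for F
    using mat_rank_free_coordinates[OF R' basis(2) that] .
  have "?r = 16" if "rank16_identity R"
    using rank16_identity_nullity[OF that] rank by auto
  moreover have "?r = 19" if "rank19_identity R"
    using rank19_identity_nullity[OF that] rank by auto
  moreover have "?r = 20" if "\<not> rank16_identity R" "\<not> rank19_identity R"
    using free_coordinates_empty[OF nonzero] that rank[of "{}"] by (simp add: R')
  ultimately show ?thesis by force
qed

end
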